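(* Let $G$ be a finite simple graph on the vertex set $[n]=\{1,\dots,n\}$, and let $e=\{u,v\}\in E(G)$ be a cut-edge of $G$ such that $v$ is a free vertex in $G\setminus e$. Then $J_G=J_{G\setminus e}+\langle x_uy_v-x_vy_u\rangle$ is a complete Betti splitting.
   Context: Let $k$ be a field and $R=k[x_1,\ldots,x_n,y_1,\ldots,y_n]$ with the standard $\mathbb{N}$-grading. For a graph $H$ with $V(H)\subseteq [n]$, its binomial edge ideal is $J_H=\langle x_iy_j-x_jy_i \mid \{i,j\}\in E(H)\rangle\subseteq R$. $G\setminus e$ is the graph with vertex set $V(G)$ and edge set $E(G)\setminus\{e\}$. An edge $e$ is a cut-edge if $G\setminus e$ has more connected components than $G$. A vertex is free in a graph if it belongs to a unique maximal clique, equivalently if its neighbours induce a complete graph. Graded Betti numbers are $\beta_{i,j}(L)=\dim_k\mathrm{Tor}_i(k,L)_j$, with $\beta_{i,j}(L)=0$ if $i<0$. If $I=J+K$ are homogeneous ideals such that a minimal homogeneous generating set of $I$ is the disjoint union of minimal homogeneous generating sets of $J$ and $K$, then $I=J+K$ is a complete Betti splitting if $\beta_{i,j}(I)=\beta_{i,j}(J)+\beta_{i,j}(K)+\beta_{i-1,j}(J\cap K)$ for all $i,j\geq 0$. *)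

theory Defs
  imports Complex_Main "HOL-Library.Poly_Mapping" "HOL-Library.Ramsey"
begin

section \<open>Graphs\<close>

text \<open>
  The vertex set \<open>[n]\<close> is a finite type \<open>'v\<close>, so \<open>n\<close> is the cardinality of \<open>'v\<close>.
  A graph on it is given by its edge set; all graphs here have all of \<open>'v\<close> as vertex set.
\<close>

definition simple_graph :: "'v set set \<Rightarrow> bool" where
  "simple_graph E \<longleftrightarrow> (\<forall>e\<in>E. card e = 2)"

definition connected_components :: "'v set set \<Rightarrow> 'v set set" where
  "connected_components E = UNIV // {(a, b). {a, b} \<in> E}\<^sup>*"

definition cut_edge :: "'v set set \<Rightarrow> 'v set \<Rightarrow> bool" where
  "cut_edge E e \<longleftrightarrow>
     e \<in> E \<and> card (connected_components (E - {e})) > card (connected_components E)"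

definition maximal_clique :: "'v set set \<Rightarrow> 'v set \<Rightarrow> bool" where
  "maximal_clique E C \<longleftrightarrow> clique C E \<and> (\<forall>C'. clique C' E \<and> C \<subseteq> C' \<longrightarrow> C' = C)"

definition free_vertex :: "'v set set \<Rightarrow> 'v \<Rightarrow> bool" where
  "free_vertex E v \<longleftrightarrow> (\<exists>!C. maximal_clique E C \<and> v \<in> C)"


section \<open>The polynomial ring\<close>

datatype 'v var = X 'v | Y 'v

text \<open>Monomials are exponent vectors; for finite \<open>'v\<close> the type \<open>('v, 'k) mpoly\<close> is
  the polynomial ring over \<open>'k\<close> in the variables \<open>X i\<close> and \<open>Y i\<close>.\<close>

type_synonym 'v monomial = "'v var \<Rightarrow>\<^sub>0 nat"
type_synonym ('v, 'k) mpoly = "'v monomial \<Rightarrow>\<^sub>0 'k"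

definition Var :: "'v var \<Rightarrow> ('v, 'k::field) mpoly" where
  "Var z = Poly_Mapping.single (Poly_Mapping.single z 1) 1"

definition Const :: "'k \<Rightarrow> ('v, 'k::field) mpoly" where
  "Const c = Poly_Mapping.single 0 c"

definition monomial_degree :: "'v monomial \<Rightarrow> nat" where
  "monomial_degree m = (\<Sum>z\<in>Poly_Mapping.keys m. Poly_Mapping.lookup m z)"

definition homogeneous_of_degree :: "int \<Rightarrow> ('v, 'k::field) mpoly \<Rightarrow> bool" where
  "homogeneous_of_degree d p \<longleftrightarrow> (\<forall>m\<in>Poly_Mapping.keys p. int (monomial_degree m) = d)"

definition homogeneous :: "('v, 'k::field) mpoly \<Rightarrow> bool" where
  "homogeneous p \<longleftrightarrow> (\<exists>d. homogeneous_of_degree d p)"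

abbreviation ideal_generated :: "'r::comm_ring_1 set \<Rightarrow> 'r set" where
  "ideal_generated \<equiv> module.span (*)"

definition homogeneous_ideal :: "('v, 'k::field) mpoly set \<Rightarrow> bool" where
  "homogeneous_ideal I \<longleftrightarrow> (\<exists>S. (\<forall>p\<in>S. homogeneous p) \<and> I = ideal_generated S)"

definition minimal_homogeneous_generators ::
    "('v, 'k::field) mpoly set \<Rightarrow> ('v, 'k) mpoly set \<Rightarrow> bool" where
  "minimal_homogeneous_generators I S \<longleftrightarrow>
     (\<forall>p\<in>S. homogeneous p) \<and> ideal_generated S = I \<and>
     (\<forall>T. T \<subset> S \<longrightarrow> ideal_generated T \<noteq> I)"

definition edge_binomial :: "'v \<Rightarrow> 'v \<Rightarrow> ('v, 'k::field) mpoly" where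
  "edge_binomial i j = Var (X i) * Var (Y j) - Var (X j) * Var (Y i)"

definition binomial_edge_ideal :: "'v set set \<Rightarrow> ('v, 'k::field) mpoly set" where
  "binomial_edge_ideal E = ideal_generated {edge_binomial i j | i j. {i, j} \<in> E}"


section \<open>Graded free resolutions of the residue field\<close>

text \<open>
  Write \<open>R\<close> for \<open>('v, 'k) mpoly\<close>.  Vectors over \<open>R\<close> are finitely supported functions on \<open>nat\<close>;
  the free module of rank \<open>r\<close> consists of those supported on \<open>{..<r}\<close>.
\<close>

type_synonym ('v, 'k) vec = "nat \<Rightarrow>\<^sub>0 ('v, 'k) mpoly"

definition vec_scale :: "('v, 'k::field) mpoly \<Rightarrow> ('v, 'k) vec \<Rightarrow> ('v, 'k) vec" where
  "vec_scale p = Poly_Mapping.map (\<lambda>q. p * q)"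

text \<open>The action of \<open>R\<close> on \<open>k = R/(x\<^sub>1,\<dots>,y\<^sub>n)\<close>: a polynomial acts by its constant coefficient.\<close>

definition residue_scale :: "('v, 'k::field) mpoly \<Rightarrow> 'k \<Rightarrow> 'k" where
  "residue_scale p c = Poly_Mapping.lookup p 0 * c"

text \<open>
  In a complex \<open>F\<close> of finitely generated graded free modules, \<open>F\<^sub>i\<close> has rank \<open>rank F i\<close>, its basis
  element number \<open>a\<close> lives in degree \<open>shift F i a\<close>, and \<open>diff F i\<close> is the differential from
  \<open>F\<^bsub>i+1\<^esub>\<close> to \<open>F\<^sub>i\<close> (extended in some \<open>R\<close>-linear way to all vectors).
\<close>

record (overloaded) ('v, 'k) free_complex =
  rank :: "nat \<Rightarrow> nat"
  shift :: "nat \<Rightarrow> nat \<Rightarrow> int"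
  diff :: "nat \<Rightarrow> ('v, 'k) vec \<Rightarrow> ('v, 'k) vec"

text \<open>
  For an ideal \<open>L\<close> the module \<open>F\<^sub>i \<otimes>\<^sub>R L\<close> is the direct sum of \<open>rank F i\<close> (shifted) copies of \<open>L\<close>,
  i.e. the submodule of \<open>F\<^sub>i\<close> of vectors with entries in \<open>L\<close>, and the differential of \<open>F \<otimes>\<^sub>R L\<close>
  is the restriction of that of \<open>F\<close>.  For \<open>L = R\<close> this is \<open>F\<^sub>i\<close> itself.
\<close>

definition tensor :: "('v, 'k::field) free_complex \<Rightarrow> ('v, 'k) mpoly set \<Rightarrow> nat \<Rightarrow> ('v, 'k) vec set" where
  "tensor F L i = {w. Poly_Mapping.keys w \<subseteq> {..<rank F i} \<and> (\<forall>a. Poly_Mapping.lookup w a \<in> L)}"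

definition tensor_piece ::
    "('v, 'k::field) free_complex \<Rightarrow> ('v, 'k) mpoly set \<Rightarrow> nat \<Rightarrow> int \<Rightarrow> ('v, 'k) vec set" where
  "tensor_piece F L i j =
     {w \<in> tensor F L i. \<forall>a<rank F i. homogeneous_of_degree (j - shift F i a) (Poly_Mapping.lookup w a)}"

text \<open>Exactness of \<open>\<dots> \<rightarrow> F\<^sub>1 \<rightarrow> F\<^sub>0 \<rightarrow> k \<rightarrow> 0\<close>, with all maps linear and homogeneous of degree 0
  and \<open>k\<close> concentrated in degree 0.\<close>

definition graded_free_resolution_of_residue_field :: "('v, 'k::field) free_complex \<Rightarrow> bool" where
  "graded_free_resolution_of_residue_field F \<longleftrightarrow>
     (\<forall>i. module_hom vec_scale vec_scale (diff F i)) \<and>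
     (\<forall>i j. diff F i ` tensor_piece F UNIV (Suc i) j \<subseteq> tensor_piece F UNIV i j) \<and>
     (\<forall>i. diff F (Suc i) ` tensor F UNIV (Suc (Suc i)) =
            {w \<in> tensor F UNIV (Suc i). diff F i w = 0}) \<and>
     (\<exists>\<epsilon>. module_hom vec_scale residue_scale \<epsilon> \<and>
          (\<forall>j. j \<noteq> 0 \<longrightarrow> \<epsilon> ` tensor_piece F UNIV 0 j \<subseteq> {0}) \<and>
          \<epsilon> ` tensor F UNIV 0 = UNIV \<and>
          diff F 0 ` tensor F UNIV (Suc 0) = {w \<in> tensor F UNIV 0. \<epsilon> w = 0})"

definition residue_field_resolution :: "('v, 'k::field) free_complex" where
  "residue_field_resolution = (SOME F. graded_free_resolution_of_residue_field F)"


section \<open>Graded Betti numbers and Betti splittings\<close>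

text \<open>\<open>S\<close> represents a basis of the quotient space \<open>Z/B\<close>: modulo \<open>B\<close>, every element of \<open>Z\<close> is a
  unique linear combination of elements of \<open>S\<close>.\<close>

definition quotient_basis ::
    "('k::field \<Rightarrow> 'b::ab_group_add \<Rightarrow> 'b) \<Rightarrow> 'b set \<Rightarrow> 'b set \<Rightarrow> 'b set \<Rightarrow> bool" where
  "quotient_basis sc Z B S \<longleftrightarrow>
     S \<subseteq> Z \<and>
     (\<forall>z\<in>Z. \<exists>!c :: 'b \<Rightarrow>\<^sub>0 'k. Poly_Mapping.keys c \<subseteq> S \<and>
        z - (\<Sum>s\<in>Poly_Mapping.keys c. sc (Poly_Mapping.lookup c s) s) \<in> B)"

definition quotient_dim ::
    "('k::field \<Rightarrow> 'b::ab_group_add \<Rightarrow> 'b) \<Rightarrow> 'b set \<Rightarrow> 'b set \<Rightarrow> nat" where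
  "quotient_dim sc Z B = card (SOME S. quotient_basis sc Z B S)"

text \<open>\<open>Tor\<^sub>i(k, L)\<^sub>j\<close> is the space of cycles modulo the space of boundaries in
  homological degree \<open>i\<close> and internal degree \<open>j\<close> of \<open>F \<otimes>\<^sub>R L\<close>, for \<open>F\<close> a resolution of \<open>k\<close>.\<close>

definition Tor_cycles :: "('v, 'k::field) mpoly set \<Rightarrow> nat \<Rightarrow> int \<Rightarrow> ('v, 'k) vec set" where
  "Tor_cycles L i j =
     {w \<in> tensor_piece residue_field_resolution L i j.
        \<forall>l. i = Suc l \<longrightarrow> diff residue_field_resolution l w = 0}"

definition Tor_boundaries :: "('v, 'k::field) mpoly set \<Rightarrow> nat \<Rightarrow> int \<Rightarrow> ('v, 'k) vec set" where
  "Tor_boundaries L i j =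
     diff residue_field_resolution i ` tensor_piece residue_field_resolution L (Suc i) j"

definition betti :: "('v, 'k::field) mpoly set \<Rightarrow> int \<Rightarrow> int \<Rightarrow> nat" where
  "betti L i j =
     (if i < 0 then 0
      else quotient_dim (\<lambda>c. vec_scale (Const c)) (Tor_cycles L (nat i) j) (Tor_boundaries L (nat i) j))"

definition complete_betti_splitting ::
    "('v, 'k::field) mpoly set \<Rightarrow> ('v, 'k) mpoly set \<Rightarrow> ('v, 'k) mpoly set \<Rightarrow> bool" where
  "complete_betti_splitting I J K \<longleftrightarrow>
     homogeneous_ideal I \<and> homogeneous_ideal J \<and> homogeneous_ideal K \<and>
     I = {a + b | a b. a \<in> J \<and> b \<in> K} \<and>
     (\<exists>S T. minimal_homogeneous_generators J S \<and> minimal_homogeneous_generators K T \<and>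
            S \<inter> T = {} \<and> minimal_homogeneous_generators I (S \<union> T)) \<and>
     (\<forall>i\<ge>0. \<forall>j\<ge>0. betti I i j = betti J i j + betti K i j + betti (J \<inter> K) (i - 1) j)"

end

theory Submission
  imports Defs
begin

text \<open>Write \<open>J\<close> for the ideal of \<open>G \ e\<close> and \<open>f = x\<^sub>u y\<^sub>v - x\<^sub>v y\<^sub>u\<close>. The splitting
  formula holds as soon as the maps \<open>Tor\<^sub>i(k, J \<inter> (f)) \<rightarrow> Tor\<^sub>i(k, J)\<close> and
  \<open>Tor\<^sub>i(k, J \<inter> (f)) \<rightarrow> Tor\<^sub>i(k, (f))\<close> vanish; the rest is dimension counting. Now
  \<open>J \<inter> (f) = f C\<close> with \<open>C = J : f\<close>. The key point is that \<open>C\<close> multiplies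
  \<open>x\<^sub>u\<close> and \<open>y\<^sub>u\<close> into \<open>J\<close>. Hence multiplication by \<open>f\<close>
  as a map \<open>C \<rightarrow> J\<close> is \<open>y\<^sub>v\<close> times the map \<open>x\<^sub>u\<close> minus \<open>x\<^sub>v\<close> times the map \<open>y\<^sub>u\<close>,
  and variables act as zero on Tor, because multiplication by a variable is null-homotopic on a
  resolution of \<open>k\<close>.

  For the key point, Ohtani's decomposition of a binomial edge ideal at a vertex with non-adjacent
  neighbours keeps \<open>v\<close> free and separated from \<open>u\<close>. It reduces to the case where
  \<open>u\<close> has been deleted, so that \<open>x\<^sub>u, y\<^sub>u\<close> lie in the ideal, or to a
  disjoint union of complete graphs, whose ideal is the kernel of a map to a domain that does not
  kill \<open>f\<close>.\<close>

text \<open>The two graph hypotheses act separately. The cut-edge gives a union \<open>V\<close> of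
  components of \<open>G \<setminus> e\<close> containing \<open>u\<close> but not \<open>v\<close>;
  both operations of the decomposition respect it, so \<open>f\<close> never joins two vertices of
  one clique. Freeness of \<open>v\<close> prevents a decomposition at \<open>v\<close>, so
  \<open>v\<close> is never deleted. Nothing protects \<open>u\<close>, whence
  \<open>x_u c, y_u c \<in> J\<close> instead of \<open>c \<in> J\<close>: for non-adjacent
  neighbours \<open>a\<close>, \<open>b\<close> of \<open>u\<close>, the binomial of
  \<open>a\<close>, \<open>b\<close> lies in \<open>C\<close>. The map into
  \<open>Tor_i(k, (f))\<close> becomes, after division by \<open>f\<close>, the map from
  \<open>Tor_i(k, C)\<close> to \<open>Tor_i(k, R)\<close>. The target vanishes for
  \<open>i > 0\<close>; for \<open>i = 0\<close> the map is zero because elements of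
  \<open>C\<close> have no constant term: \<open>x_u C \<subseteq> J\<close>, and \<open>J\<close>
  contains no linear form. All modules \<open>F_i \<otimes> L\<close> are submodules of the same
  free module, so intersections and sums of subspaces replace connecting homomorphisms. Since
  \<open>betti\<close> refers to a chosen resolution, the argument runs for an arbitrary one, and
  existence is proved separately by a Koszul construction.\<close>

abbreviation "lookup \<equiv> Poly_Mapping.lookup"
abbreviation "keys \<equiv> Poly_Mapping.keys"
abbreviation "single \<equiv> Poly_Mapping.single"

lemma UNIV_var: "UNIV = range X \<union> range Y"
proof -
  have "z \<in> range X \<union> range Y" for z :: "'a var" by (cases z) auto
  then show ?thesis by blast
qed

instance var :: (finite) finite
  by standard (simp add: UNIV_var)

lemma poly_mapping_sum_monomials: "(\<Sum>m\<in>keys p. single m (lookup p m)) = p"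
  by (rule poly_mapping_eqI)
    (auto simp: lookup_sum lookup_single in_keys_iff when_def if_distrib sum.delta cong: if_cong)

lemma poly_mapping_induct [case_names single add]:
  fixes p :: "'a \<Rightarrow>\<^sub>0 'b::comm_monoid_add"
  assumes "\<And>m c. Q (single m c)" and "\<And>p q. Q p \<Longrightarrow> Q q \<Longrightarrow> Q (p + q)"
  shows "Q p"
proof -
  have "Q 0" using assms(1)[of _ 0] by simp
  have "finite A \<Longrightarrow> Q (\<Sum>m\<in>A. single m (lookup p m))" for A
    by (induction A rule: finite_induct) (use assms \<open>Q 0\<close> in auto)
  then show ?thesis by (metis poly_mapping_sum_monomials finite_keys)
qed

section \<open>Maps induced by maps of exponents\<close>

text \<open>One device for all maps that send each monomial to a monomial or to zero: substitutions
  of variables, projections to a degree, and truncation or reindexing of vectors. \<open>P\<close>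
  selects the surviving exponents, \<open>h\<close> moves them.\<close>

definition mono_map :: "('a \<Rightarrow> bool) \<Rightarrow> ('a \<Rightarrow> 'b) \<Rightarrow> ('a \<Rightarrow>\<^sub>0 'c::comm_monoid_add) \<Rightarrow> 'b \<Rightarrow>\<^sub>0 'c" where
  "mono_map P h p = (\<Sum>m\<in>keys p. if P m then single (h m) (lookup p m) else 0)"

lemma mono_map_0 [simp]: "mono_map P h 0 = 0"
  by (simp add: mono_map_def)

lemma mono_map_single: "mono_map P h (single m c) = (if P m then single (h m) c else 0)"
  by (simp add: mono_map_def)

lemma mono_map_add: "mono_map P h (p + q) = mono_map P h p + mono_map P h q"
  unfolding mono_map_def
  by (rule setsum_keys_plus_distrib) (simp_all add: single_add)

lemma mono_map_diff:
  fixes p q :: "'a \<Rightarrow>\<^sub>0 'c::ab_group_add"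
  shows "mono_map P h (p - q) = mono_map P h p - mono_map P h q"
  using mono_map_add[of P h "p - q" q] by (simp add: algebra_simps)

lemma lookup_mono_map_id: "lookup (mono_map P (\<lambda>m. m) p) m = (if P m then lookup p m else 0)"
  by (induction p rule: poly_mapping_induct)
    (auto simp: mono_map_single mono_map_add lookup_add lookup_single when_def)

lemma mono_map_mult:
  fixes p q :: "'a::comm_monoid_add \<Rightarrow>\<^sub>0 'c::comm_semiring_0"
    and h :: "'a \<Rightarrow> 'b::comm_monoid_add"
  assumes P: "\<And>m m'. P (m + m') \<longleftrightarrow> P m \<and> P m'" and h: "\<And>m m'. h (m + m') = h m + h m'"
  shows "mono_map P h (p * q) = mono_map P h p * mono_map P h q"
proof (induction p rule: poly_mapping_induct)
  case (single m c)
  show ?case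
    by (induction q rule: poly_mapping_induct)
      (auto simp: mult_single mono_map_single P h mono_map_add distrib_left)
qed (simp add: mono_map_add distrib_right)

lemma lookup_mono_map_inj:
  assumes "inj h"
  shows "lookup (mono_map (\<lambda>_. True) h p) (h m) = lookup p m"
  by (induction p rule: poly_mapping_induct)
    (auto simp: mono_map_single mono_map_add lookup_add lookup_single when_def inj_eq[OF assms])

section \<open>The polynomial ring is a domain\<close>

text \<open>The domain property rests on a linear order of the exponents compatible with addition.
  Numbering the variables by \<open>i\<close> embeds the exponents into
  \<open>nat \<Rightarrow>\<^sub>0 nat\<close>, which has such an order, and \<open>H\<close> is the
  induced injective ring homomorphism.\<close>

lemma mpoly_no_zero_divisors:
  fixes p q :: "('v::finite, 'k::field) mpoly"
  assumes "p * q = 0"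
  shows "p = 0 \<or> q = 0"
proof -
  obtain i :: "'v var \<Rightarrow> nat" where i: "inj i"
    using finite_imp_inj_to_nat_seg[of "UNIV :: 'v var set"] by auto
  define h :: "'v monomial \<Rightarrow> (nat \<Rightarrow>\<^sub>0 nat)" where "h = mono_map (\<lambda>_. True) i"
  have "inj h"
  proof (rule injI, rule poly_mapping_eqI)
    fix m m' z assume "h m = h m'"
    then show "lookup m z = lookup m' z"
      using lookup_mono_map_inj[OF i] by (metis h_def)
  qed
  define H :: "('v, 'k) mpoly \<Rightarrow> ((nat \<Rightarrow>\<^sub>0 nat) \<Rightarrow>\<^sub>0 'k)" where "H = mono_map (\<lambda>_. True) h"
  have H0: "r = 0" if "H r = 0" for r
    by (rule poly_mapping_eqI) (metis H_def \<open>inj h\<close> lookup_mono_map_inj lookup_zero that)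
  have "H p * H q = H (p * q)"
    by (simp add: H_def h_def mono_map_mult mono_map_add)
  then show ?thesis using assms H0 by (auto simp: H_def)
qed

lemma mpoly_mult_eq_0_iff:
  fixes p q :: "('v::finite, 'k::field) mpoly"
  shows "p * q = 0 \<longleftrightarrow> p = 0 \<or> q = 0"
  using mpoly_no_zero_divisors by auto

section \<open>Ideals\<close>

lemma module_mult: "module ((*) :: 'r::comm_ring_1 \<Rightarrow> 'r \<Rightarrow> 'r)"
  by unfold_locales (auto simp: algebra_simps)

definition ideal :: "'r::comm_ring_1 set \<Rightarrow> bool" where
  "ideal I \<longleftrightarrow> module.subspace (*) I"

lemma ideal_iff:
  "ideal I \<longleftrightarrow> 0 \<in> I \<and> (\<forall>a\<in>I. \<forall>b\<in>I. a + b \<in> I) \<and> (\<forall>c. \<forall>a\<in>I. c * a \<in> I)"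
  by (simp add: ideal_def module.subspace_def[OF module_mult])

lemma ideal_ideal_generated [simp]: "ideal (ideal_generated S)"
  by (simp add: ideal_def module.subspace_span[OF module_mult])

lemma ideal_UNIV [simp]: "ideal UNIV" by (simp add: ideal_iff)

lemma ideal_Int: "ideal I \<Longrightarrow> ideal J \<Longrightarrow> ideal (I \<inter> J)" by (auto simp: ideal_iff)

lemma ideal_zero: "ideal I \<Longrightarrow> 0 \<in> I" by (simp add: ideal_iff)
lemma ideal_add: "ideal I \<Longrightarrow> a \<in> I \<Longrightarrow> b \<in> I \<Longrightarrow> a + b \<in> I" by (simp add: ideal_iff)
lemma ideal_mult: "ideal I \<Longrightarrow> a \<in> I \<Longrightarrow> c * a \<in> I" by (simp add: ideal_iff)
lemma ideal_mult_right: "ideal I \<Longrightarrow> a \<in> I \<Longrightarrow> a * c \<in> I"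
  using ideal_mult[of I a c] by (simp add: mult.commute)
lemma ideal_minus: "ideal I \<Longrightarrow> a \<in> I \<Longrightarrow> - a \<in> I" using ideal_mult[of I a "-1"] by simp
lemma ideal_diff: "ideal I \<Longrightarrow> a \<in> I \<Longrightarrow> b \<in> I \<Longrightarrow> a - b \<in> I"
  using ideal_add[of I a "- b"] ideal_minus by fastforce
lemma ideal_sum: "ideal I \<Longrightarrow> (\<And>x. x \<in> A \<Longrightarrow> f x \<in> I) \<Longrightarrow> sum f A \<in> I"
  by (induction A rule: infinite_finite_induct) (auto simp: ideal_zero ideal_add)

lemma ideal_generated_base: "a \<in> S \<Longrightarrow> a \<in> ideal_generated S"
  by (rule module.span_base[OF module_mult])

lemma ideal_generated_subset: "ideal I \<Longrightarrow> S \<subseteq> I \<Longrightarrow> ideal_generated S \<subseteq> I"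
  unfolding ideal_def by (rule module.span_minimal[OF module_mult])

lemma ideal_generated_mono: "S \<subseteq> T \<Longrightarrow> ideal_generated S \<subseteq> ideal_generated T"
  by (rule module.span_mono[OF module_mult])

lemma ideal_generated_induct [consumes 1, case_names zero add]:
  assumes "p \<in> ideal_generated S"
    and "Q 0" and "\<And>c s q. s \<in> S \<Longrightarrow> q \<in> ideal_generated S \<Longrightarrow> Q q \<Longrightarrow> Q (c * s + q)"
  shows "Q p"
proof -
  have "Q p \<and> p \<in> ideal_generated S"
    by (rule module.span_induct_alt[OF module_mult assms(1)])
      (auto intro: assms ideal_zero ideal_add[OF ideal_ideal_generated]
        ideal_mult[OF ideal_ideal_generated] ideal_generated_base)
  then show ?thesis ..
qed

lemma ideal_generated_Un:
  "ideal_generated (S \<union> T) = {a + b | a b. a \<in> ideal_generated S \<and> b \<in> ideal_generated T}"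
  by (rule module.span_Un[OF module_mult])

lemma ideal_generated_singleton: "ideal_generated {f} = range (\<lambda>c. c * f)"
  by (rule module.span_singleton[OF module_mult])

section \<open>Binomial edge ideals\<close>

text \<open>\<open>S\<close> records deleted vertices: deleting a vertex in the decomposition puts
  both of its variables into the ideal, and this larger family is closed under the
  recursion.\<close>

definition vertex_edge_ideal :: "'v set \<Rightarrow> 'v set set \<Rightarrow> ('v, 'k::field) mpoly set" where
  "vertex_edge_ideal S E = ideal_generated
     ((\<lambda>i. Var (X i)) ` S \<union> (\<lambda>i. Var (Y i)) ` S \<union> {edge_binomial i j | i j. {i, j} \<in> E})"

lemma binomial_edge_ideal_eq: "binomial_edge_ideal E = vertex_edge_ideal {} E"
  by (simp add: binomial_edge_ideal_def vertex_edge_ideal_def)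

lemma ideal_vertex_edge_ideal [simp]: "ideal (vertex_edge_ideal S E)"
  by (simp add: vertex_edge_ideal_def)

lemma ideal_binomial_edge_ideal [simp]: "ideal (binomial_edge_ideal E)"
  by (simp add: binomial_edge_ideal_def)

lemma vertex_edge_ideal_base:
  "i \<in> S \<Longrightarrow> Var (X i) \<in> vertex_edge_ideal S E"
  "i \<in> S \<Longrightarrow> Var (Y i) \<in> vertex_edge_ideal S E"
  "{i, j} \<in> E \<Longrightarrow> edge_binomial i j \<in> vertex_edge_ideal S E"
  unfolding vertex_edge_ideal_def by (auto intro!: ideal_generated_base)

lemma vertex_edge_ideal_subset:
  assumes "ideal I" "\<And>i. i \<in> S \<Longrightarrow> Var (X i) \<in> I" "\<And>i. i \<in> S \<Longrightarrow> Var (Y i) \<in> I"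
    "\<And>i j. {i, j} \<in> E \<Longrightarrow> edge_binomial i j \<in> I"
  shows "vertex_edge_ideal S E \<subseteq> I"
  unfolding vertex_edge_ideal_def using assms by (intro ideal_generated_subset) auto

section \<open>Decomposition at a vertex: completing its neighbourhood, or deleting it\<close>

definition complete_at :: "'v \<Rightarrow> 'v set set \<Rightarrow> 'v set set" where
  "complete_at w E = E \<union> {{i, j} | i j. i \<noteq> j \<and> {w, i} \<in> E \<and> {w, j} \<in> E}"

definition delete_vertex :: "'v \<Rightarrow> 'v set set \<Rightarrow> 'v set set" where
  "delete_vertex w E = {e \<in> E. w \<notin> e}"

lemma simple_graph_neq: "simple_graph E \<Longrightarrow> {a, b} \<in> E \<Longrightarrow> a \<noteq> b"
  by (auto simp: simple_graph_def)

lemma mono_split: "lookup m z \<noteq> 0 \<Longrightarrow> (m - single z 1) + single z (1::nat) = m"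
  by (rule poly_mapping_eqI) (auto simp: lookup_add lookup_minus lookup_single when_def)

lemma Var_mult_single: "Var z * single m c = single (single z 1 + m) c"
  by (simp add: Var_def mult_single)

lemma single_in_ideal:
  assumes "ideal I" "Var z \<in> I" "lookup m z \<noteq> 0"
  shows "single m c \<in> I"
proof -
  have "single m c = single (m - single z 1) c * Var z"
    using mono_split[OF assms(3)] by (simp add: Var_def mult_single)
  then show ?thesis using assms by (simp add: ideal_mult)
qed

text \<open>The substitution \<open>x_i = y_i = 0\<close> for \<open>i\<close> in \<open>W\<close>.
  It is an idempotent ring endomorphism, so \<open>drop_vars W h = h\<close> expresses that
  \<open>h\<close> does not involve these variables.\<close>

definition drop_vars :: "'v set \<Rightarrow> ('v, 'k::field) mpoly \<Rightarrow> ('v, 'k) mpoly" where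
  "drop_vars W = mono_map (\<lambda>m. \<forall>i\<in>W. lookup m (X i) = 0 \<and> lookup m (Y i) = 0) (\<lambda>m. m)"

lemma drop_vars_mult: "drop_vars W (p * q) = drop_vars W p * drop_vars W q"
  unfolding drop_vars_def by (rule mono_map_mult) (auto simp: lookup_add)

lemma drop_vars_add: "drop_vars W (p + q) = drop_vars W p + drop_vars W q"
  by (simp add: drop_vars_def mono_map_add)

lemma drop_vars_diff: "drop_vars W (p - q) = drop_vars W p - drop_vars W q"
  by (simp add: drop_vars_def mono_map_diff)

lemma drop_vars_0 [simp]: "drop_vars W 0 = 0"
  by (simp add: drop_vars_def)

lemma drop_vars_drop_vars: "drop_vars W (drop_vars W p) = drop_vars W p"
  by (rule poly_mapping_eqI) (simp add: drop_vars_def lookup_mono_map_id)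

lemma drop_vars_Var:
  "drop_vars W (Var (X i)) = (if i \<in> W then 0 else Var (X i))"
  "drop_vars W (Var (Y i)) = (if i \<in> W then 0 else Var (Y i))"
  by (auto simp: drop_vars_def Var_def mono_map_single lookup_single when_def)

lemma drop_vars_edge_binomial:
  "drop_vars W (edge_binomial i j) = (if i \<in> W \<or> j \<in> W then 0 else edge_binomial i j)"
  by (auto simp: edge_binomial_def drop_vars_mult drop_vars_diff drop_vars_Var)

lemma diff_drop_vars_in_ideal:
  assumes "ideal I" "\<And>i. i \<in> W \<Longrightarrow> Var (X i) \<in> I" "\<And>i. i \<in> W \<Longrightarrow> Var (Y i) \<in> I"
  shows "p - drop_vars W p \<in> I"
proof (induction p rule: poly_mapping_induct)
  case (single m c)
  show ?case
  proof (cases "\<forall>i\<in>W. lookup m (X i) = 0 \<and> lookup m (Y i) = 0")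
    case True
    then show ?thesis by (simp add: drop_vars_def mono_map_single ideal_zero assms)
  next
    case False
    then have "single m c \<in> I"
      using assms single_in_ideal by blast
    then show ?thesis using False by (auto simp: drop_vars_def mono_map_single)
  qed
next
  case (add p q)
  have eq: "p + q - drop_vars W (p + q) = (p - drop_vars W p) + (q - drop_vars W q)"
    by (simp add: drop_vars_add)
  show ?case unfolding eq by (rule ideal_add[OF assms(1) add])
qed

text \<open>Both terms of the binomial of an edge at \<open>w\<close> are divisible by
  \<open>x_w\<close> or \<open>y_w\<close>; all other edges survive the deletion.\<close>

lemma vertex_edge_ideal_delete:
  "vertex_edge_ideal S E \<subseteq> (vertex_edge_ideal (insert w S) (delete_vertex w E) :: ('v, 'k::field) mpoly set)"
    (is "_ \<subseteq> ?N")
proof (rule vertex_edge_ideal_subset)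
  fix i j assume ij: "{i, j} \<in> E"
  have w: "Var (X w) \<in> ?N" "Var (Y w) \<in> ?N" by (auto intro: vertex_edge_ideal_base)
  show "edge_binomial i j \<in> ?N"
  proof (cases "w \<in> {i, j}")
    case True
    have "Var z * Var z' \<in> ?N" if "z \<in> {X w, Y w} \<or> z' \<in> {X w, Y w}" for z z'
      using that w ideal_mult[OF ideal_vertex_edge_ideal] ideal_mult_right[OF ideal_vertex_edge_ideal]
      by fast
    then show ?thesis
      using True unfolding edge_binomial_def by (intro ideal_diff) auto
  next
    case False
    then show ?thesis using ij by (intro vertex_edge_ideal_base) (auto simp: delete_vertex_def)
  qed
qed (auto intro: vertex_edge_ideal_base)

lemma ideal_colon: "ideal I \<Longrightarrow> ideal {p. p * s \<in> I}"
  unfolding ideal_iff by (auto simp: distrib_right mult.assoc)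

text \<open>Ohtani's decomposition. The binomials of the edges added at \<open>w\<close> are multiplied into the ideal
  of \<open>E\<close> by \<open>x\<^sub>w\<close> and \<open>y\<^sub>w\<close>, so modulo that ideal their coefficients do not involve
  these two variables.\<close>

lemma vertex_edge_ideal_decompose:
  fixes g :: "('v, 'k::field) mpoly"
  assumes E: "simple_graph E" and w: "w \<notin> S"
    and g1: "g \<in> vertex_edge_ideal S (complete_at w E)"
    and g2: "g \<in> vertex_edge_ideal (insert w S) (delete_vertex w E)"
  shows "g \<in> vertex_edge_ideal S E"
proof -
  let ?J = "vertex_edge_ideal S E :: ('v, 'k) mpoly set"
  let ?N = "vertex_edge_ideal (insert w S) (delete_vertex w E) :: ('v, 'k) mpoly set"
  let ?\<rho> = "drop_vars {w} :: ('v, 'k) mpoly \<Rightarrow> _"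
  have "\<exists>h. ?\<rho> h = h \<and> g - h \<in> ?J"
    using g1 unfolding vertex_edge_ideal_def[of S "complete_at w E"]
  proof (induction rule: ideal_generated_induct)
    case zero
    then show ?case by (intro exI[of _ 0]) (simp add: ideal_zero)
  next
    case (add c s q)
    then obtain h where h: "?\<rho> h = h" "q - h \<in> ?J" by blast
    show ?case
    proof (cases "s \<in> ?J")
      case True
      then have "c * s + (q - h) \<in> ?J"
        using h by (intro ideal_add ideal_mult) auto
      then show ?thesis using h by (metis add_diff_eq)
    next
      case False
      then obtain i j where s: "s = edge_binomial i j" "{i, j} \<in> complete_at w E"
        using add(1) False by (auto intro: vertex_edge_ideal_base)
      then obtain a b where ab: "{i, j} = {a, b}" "{w, a} \<in> E" "{w, b} \<in> E"
        using vertex_edge_ideal_base(3)[of i j E S] False unfolding complete_at_def by fastforce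
      then have wi: "{w, i} \<in> E" and wj: "{w, j} \<in> E"
        by (auto simp: doubleton_eq_iff)
      then have ne: "w \<noteq> i" "w \<noteq> j" using E simple_graph_neq by metis+
      \<comment> \<open>Expansion along the first row of the vanishing 3 by 3 determinants with rows
        \<open>x, x, y\<close> and \<open>y, x, y\<close> in the columns
        \<open>w, i, j\<close>.\<close>
      have "Var (X w) * s = Var (X i) * edge_binomial w j - Var (X j) * edge_binomial w i"
           "Var (Y w) * s = Var (Y i) * edge_binomial w j - Var (Y j) * edge_binomial w i"
        by (simp_all add: s edge_binomial_def algebra_simps)
      then have "Var (X w) * s \<in> ?J" "Var (Y w) * s \<in> ?J"
        using wi wj by (auto intro!: ideal_diff ideal_mult vertex_edge_ideal_base)
      then have "c - ?\<rho> c \<in> {p. p * s \<in> ?J}"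
        by (intro diff_drop_vars_in_ideal ideal_colon) auto
      then have "(c - ?\<rho> c) * s + (q - h) \<in> ?J"
        using h by (intro ideal_add) auto
      then have "c * s + q - (?\<rho> c * s + h) \<in> ?J"
        by (simp add: algebra_simps)
      moreover have "?\<rho> (?\<rho> c * s + h) = ?\<rho> c * s + h"
        using ne h by (simp add: drop_vars_add drop_vars_mult drop_vars_drop_vars s
            drop_vars_edge_binomial)
      ultimately show ?thesis by blast
    qed
  qed
  then obtain h where h: "?\<rho> h = h" "g - h \<in> ?J" by blast
  have "?J \<subseteq> ?N" by (rule vertex_edge_ideal_delete)
  then have "h \<in> ?N"
    using ideal_diff[of ?N g "g - h"] g2 h by auto
  \<comment> \<open>Setting \<open>x_w = y_w = 0\<close> sends each generator of \<open>?N\<close>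
    to zero or to a generator of \<open>?J\<close>. Since \<open>h\<close> is fixed by this
    substitution, \<open>h \<in> ?N\<close> yields \<open>h \<in> ?J\<close>.\<close>
  moreover have "?N \<subseteq> {p. ?\<rho> p \<in> ?J}"
  proof (rule vertex_edge_ideal_subset)
    show "ideal {p. ?\<rho> p \<in> ?J}"
      unfolding ideal_iff
      by (auto simp: drop_vars_add drop_vars_mult ideal_zero ideal_add ideal_mult)
  qed (auto simp: drop_vars_Var drop_vars_edge_binomial delete_vertex_def ideal_zero
      intro: vertex_edge_ideal_base)
  ultimately have "h \<in> ?J" using h by auto
  then show ?thesis using ideal_add[of ?J h "g - h"] h by simp
qed


section \<open>Disjoint unions of complete graphs\<close>

text \<open>Exponent part of the substitution \<open>x_i \<mapsto> x_i\<close>,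
  \<open>y_i \<mapsto> x_i y_r\<close> with \<open>r = rep i\<close>. On each class of
  \<open>rep\<close> it parametrises the matrices with rows \<open>x\<close>, \<open>y\<close> of
  rank at most one, which is why the binomials inside a class vanish.\<close>

definition clique_exponent :: "('v \<Rightarrow> 'v) \<Rightarrow> 'v::finite monomial \<Rightarrow> 'v monomial" where
  "clique_exponent rep m = Abs_poly_mapping (\<lambda>z. case z of
     X i \<Rightarrow> lookup m (X i) + lookup m (Y i) | Y r \<Rightarrow> \<Sum>i | rep i = r. lookup m (Y i))"

lemma lookup_clique_exponent:
  "lookup (clique_exponent rep m) (X i) = lookup m (X i) + lookup m (Y i)"
  "lookup (clique_exponent rep m) (Y r) = (\<Sum>i | rep i = r. lookup m (Y i))"
  by (simp_all add: clique_exponent_def)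

lemma clique_exponent_add:
  "clique_exponent rep (m + m') = clique_exponent rep m + clique_exponent rep m'"
proof (rule poly_mapping_eqI)
  fix z show "lookup (clique_exponent rep (m + m')) z =
      lookup (clique_exponent rep m + clique_exponent rep m') z"
    by (cases z) (simp_all add: lookup_add lookup_clique_exponent sum.distrib)
qed

lemma clique_exponent_single:
  "clique_exponent rep (single (X i) 1) = single (X i) 1"
  "clique_exponent rep (single (Y i) 1) = single (X i) 1 + single (Y (rep i)) 1"
proof -
  show "clique_exponent rep (single (X i) 1) = single (X i) 1"
  proof (rule poly_mapping_eqI)
    fix z show "lookup (clique_exponent rep (single (X i) 1)) z = lookup (single (X i) 1) z"
      by (cases z) (simp_all add: lookup_clique_exponent lookup_single)
  qed
  show "clique_exponent rep (single (Y i) 1) = single (X i) 1 + single (Y (rep i)) 1"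
  proof (rule poly_mapping_eqI)
    fix z show "lookup (clique_exponent rep (single (Y i) 1)) z =
        lookup (single (X i) 1 + single (Y (rep i)) 1) z"
      by (cases z) (auto simp: lookup_clique_exponent lookup_single lookup_add when_def)
  qed
qed

text \<open>Monomials in one fibre are connected by moves \<open>x_j y_i \<mapsto> x_i y_j\<close>
  inside a class. The class totals of the \<open>y\<close>-exponents agree, so a surplus at some
  \<open>i\<close> comes with a deficit at some \<open>j\<close> of the same class, and the move at
  \<open>i\<close>, \<open>j\<close> lowers the total surplus. Truncated subtraction makes the
  measure count surpluses only.\<close>

lemma clique_exponent_congruent:
  fixes I :: "('v::finite, 'k::field) mpoly set"
  assumes I: "ideal I" and rep: "\<And>i j. i \<noteq> j \<Longrightarrow> rep i = rep j \<Longrightarrow> edge_binomial i j \<in> I"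
    and "clique_exponent rep m = clique_exponent rep m'"
  shows "single m c - single m' c \<in> I"
  using assms(3)
proof (induction "\<Sum>i\<in>UNIV. lookup m (Y i) - lookup m' (Y i)" arbitrary: m rule: less_induct)
  case less
  have X: "lookup m (X i) + lookup m (Y i) = lookup m' (X i) + lookup m' (Y i)" for i
    using less.prems by (metis lookup_clique_exponent(1))
  have Y: "(\<Sum>i | rep i = r. lookup m (Y i)) = (\<Sum>i | rep i = r. lookup m' (Y i))" for r
    using less.prems by (metis lookup_clique_exponent(2))
  show ?case
  proof (cases "\<forall>i. lookup m (Y i) = lookup m' (Y i)")
    case True
    have Xeq: "lookup m (X i) = lookup m' (X i)" for i using X[of i] True by simp
    have "m = m'"
    proof (rule poly_mapping_eqI)
      fix z show "lookup m z = lookup m' z"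
        using Xeq True by (cases z) blast+
    qed
    then show ?thesis using I by (simp add: ideal_zero)
  next
    case False
    then obtain l where l: "lookup m (Y l) \<noteq> lookup m' (Y l)" by blast
    let ?C = "{i. rep i = rep l}"
    have "\<exists>i\<in>?C. lookup m' (Y i) < lookup m (Y i)"
    proof (rule ccontr)
      assume "\<not> ?thesis"
      then have "(\<Sum>i\<in>?C. lookup m (Y i)) < (\<Sum>i\<in>?C. lookup m' (Y i))"
        using l by (intro sum_strict_mono_ex1) (auto simp: not_less le_less)
      then show False using Y by simp
    qed
    then obtain i where i: "rep i = rep l" "lookup m' (Y i) < lookup m (Y i)" by blast
    have "\<exists>j\<in>?C. lookup m (Y j) < lookup m' (Y j)"
    proof (rule ccontr)
      assume "\<not> ?thesis"
      then have "(\<Sum>i\<in>?C. lookup m' (Y i)) < (\<Sum>i\<in>?C. lookup m (Y i))"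
        using l by (intro sum_strict_mono_ex1) (auto simp: not_less le_less)
      then show False using Y by simp
    qed
    then obtain j where j: "rep j = rep l" "lookup m (Y j) < lookup m' (Y j)" by blast
    have ij: "i \<noteq> j" using i j by auto
    \<comment> \<open>The sum of the two exponents at \<open>j\<close> is the same in
      \<open>m\<close> and \<open>m'\<close>, so a deficit of \<open>y_j\<close> in \<open>m\<close>
      forces \<open>x_j\<close> to divide \<open>m\<close>.\<close>
    have Xj: "lookup m (X j) \<noteq> 0" using X[of j] j by linarith
    define m0 where "m0 = m - single (Y i) 1 - single (X j) 1"
    have m: "m = m0 + single (X j) 1 + single (Y i) 1"
      unfolding m0_def using i Xj
      by (intro poly_mapping_eqI) (auto simp: lookup_add lookup_minus lookup_single when_def)
    define m1 where "m1 = m0 + single (X i) 1 + single (Y j) 1"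
    have "clique_exponent rep m1 = clique_exponent rep m"
      by (simp add: m m1_def clique_exponent_add clique_exponent_single[simplified] i j algebra_simps)
    moreover have "(\<Sum>i\<in>UNIV. lookup m1 (Y i) - lookup m' (Y i)) <
        (\<Sum>i\<in>UNIV. lookup m (Y i) - lookup m' (Y i))"
    proof (rule sum_strict_mono_ex1)
      show "\<forall>x\<in>UNIV. lookup m1 (Y x) - lookup m' (Y x) \<le> lookup m (Y x) - lookup m' (Y x)"
        using i j by (auto simp: m m1_def lookup_add lookup_single when_def)
      show "\<exists>x\<in>UNIV. lookup m1 (Y x) - lookup m' (Y x) < lookup m (Y x) - lookup m' (Y x)"
        using i j ij by (intro bexI[of _ i]) (auto simp: m m1_def lookup_add lookup_single when_def)
    qed simp
    ultimately have "single m1 c - single m' c \<in> I"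
      using less by simp
    moreover have "single m c - single m1 c = - single m0 c * edge_binomial i j"
      by (simp add: m m1_def edge_binomial_def Var_def mult_single algebra_simps)
    then have "single m c - single m1 c \<in> I"
      using ideal_mult[OF I rep[OF ij]] i j by metis
    ultimately show ?thesis
      using ideal_add[OF I, of "single m c - single m1 c" "single m1 c - single m' c"] by simp
  qed
qed

text \<open>A choice \<open>n\<close> of one preimage for each exponent in the image of
  \<open>h\<close> defines a map back which inverts \<open>mono_map P h\<close> modulo
  \<open>I\<close>: a monomial is either killed, hence in \<open>I\<close>, or replaced by another
  one of its fibre.\<close>

lemma mono_map_kernel:
  fixes p :: "('v, 'k::field) mpoly"
  assumes I: "ideal I" and "\<And>m c. \<not> P m \<Longrightarrow> single m c \<in> I"
    and h: "\<And>m m' c. h m = h m' \<Longrightarrow> single m c - single m' c \<in> I"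
    and "mono_map P h p = 0"
  shows "p \<in> I"
proof -
  define n where "n t = (SOME m. h m = t)" for t
  have n: "h (n (h m)) = h m" for m
    unfolding n_def by (rule someI) (rule refl)
  have "q - mono_map (\<lambda>_. True) n (mono_map P h q) \<in> I" for q
  proof (induction q rule: poly_mapping_induct)
    case (single m c)
    show ?case using assms(2)[of m c] h[of m "n (h m)" c] n by (simp add: mono_map_single)
  next
    case (add p q)
    then show ?case using ideal_add[OF I add] by (simp add: mono_map_add algebra_simps)
  qed
  from this[of p] show ?thesis using assms(4) by simp
qed

lemma Var_nonzero [simp]: "Var z \<noteq> 0"
proof
  assume "Var z = (0 :: ('a, 'b) mpoly)"
  then have "lookup (Var z :: ('a, 'b) mpoly) (single z 1) = 0" by simp
  then show False by (simp add: Var_def)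
qed

lemma Var_inj: "Var z = Var z' \<longleftrightarrow> z = z'"
proof
  assume "(Var z :: ('a, 'b) mpoly) = Var z'"
  then have "lookup (Var z :: ('a, 'b) mpoly) (single z 1) = lookup (Var z') (single z 1)" by simp
  then have "single z (1::nat) = single z' 1"
    by (auto simp: Var_def lookup_single when_def split: if_splits)
  then have "lookup (single z (1::nat)) z = lookup (single z' 1) z" by simp
  then show "z = z'" by (auto simp: lookup_single when_def split: if_splits)
qed simp

text \<open>The ideal is the kernel of the ring homomorphism \<open>\<phi>\<close> that kills the
  variables at \<open>S\<close> and applies the rank-one substitution on each clique. As
  \<open>u\<close> and \<open>v\<close> lie in different cliques outside \<open>S\<close>,
  \<open>\<phi>\<close> sends the binomial to \<open>x_u x_v\<close> times a difference of two
  distinct variables, which can be cancelled in a domain.\<close>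

lemma cliques_nonzerodivisor:
  fixes c :: "('v::finite, 'k::field) mpoly"
  assumes S: "\<forall>e\<in>E. e \<inter> S = {}"
    and cl: "\<And>w a b. {w, a} \<in> E \<Longrightarrow> {w, b} \<in> E \<Longrightarrow> a \<noteq> b \<Longrightarrow> {a, b} \<in> E"
    and uv: "u \<noteq> v" "{u, v} \<notin> E" "\<nexists>r. {u, r} \<in> E \<and> {v, r} \<in> E" and nS: "u \<notin> S" "v \<notin> S"
    and c: "c * edge_binomial u v \<in> vertex_edge_ideal S E"
  shows "c \<in> vertex_edge_ideal S E"
proof -
  let ?J = "vertex_edge_ideal S E :: ('v, 'k) mpoly set"
  \<comment> \<open>Including \<open>i\<close> itself makes isolated vertices classes of their own.
    Adjacent vertices have the same set \<open>cls\<close>, so the choice \<open>rep\<close>, which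
    depends on that set only, is constant on cliques.\<close>
  define cls where "cls i = {j. j = i \<or> {i, j} \<in> E}" for i
  define rep where "rep i = (SOME j. j \<in> cls i)" for i
  have rep: "rep i \<in> cls i" for i
    unfolding rep_def by (rule someI[of _ i]) (simp add: cls_def)
  have cls_sub: "cls i \<subseteq> cls j" if "{i, j} \<in> E" for i j
    using that cl[of i j] by (auto simp: cls_def insert_commute)
  have rep_edge: "rep i = rep j" if "{i, j} \<in> E" for i j
  proof -
    have "{j, i} \<in> E" using that by (simp add: insert_commute)
    then have "cls i = cls j" using cls_sub that by blast
    then show ?thesis by (simp add: rep_def)
  qed
  have rep_eq: "{i, j} \<in> E" if "i \<noteq> j" "rep i = rep j" for i j
  proof -
    define r where "r = rep i"
    have "r = i \<or> {i, r} \<in> E" "r = j \<or> {j, r} \<in> E"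
      using rep[of i] rep[of j] that unfolding cls_def r_def by auto
    then have "r = i \<or> {r, i} \<in> E" "r = j \<or> {r, j} \<in> E" "r = j \<Longrightarrow> {i, j} \<in> E"
      using that(1) by (metis insert_commute)+
    then show ?thesis using cl[of r i j] that(1) by blast
  qed
  define P where "P m \<longleftrightarrow> (\<forall>i\<in>S. lookup m (X i) = 0 \<and> lookup m (Y i) = 0)" for m :: "'v monomial"
  define \<phi> :: "('v, 'k) mpoly \<Rightarrow> ('v, 'k) mpoly" where "\<phi> = mono_map P (clique_exponent rep)"
  have mult: "\<phi> (p * q) = \<phi> p * \<phi> q" for p q
    unfolding \<phi>_def by (rule mono_map_mult) (auto simp: P_def lookup_add clique_exponent_add)
  have diff: "\<phi> (p - q) = \<phi> p - \<phi> q" for p q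
    by (simp add: \<phi>_def mono_map_diff)
  have \<phi>X: "\<phi> (Var (X i)) = (if i \<in> S then 0 else Var (X i))" for i
    by (auto simp: \<phi>_def Var_def mono_map_single P_def lookup_single when_def
        clique_exponent_single[simplified])
  have \<phi>Y: "\<phi> (Var (Y i)) = (if i \<in> S then 0 else Var (X i) * Var (Y (rep i)))" for i
    by (auto simp: \<phi>_def Var_def mono_map_single P_def lookup_single when_def mult_single
        clique_exponent_single[simplified])
  have \<phi>e: "\<phi> (edge_binomial i j) = Var (X i) * Var (X j) * (Var (Y (rep j)) - Var (Y (rep i)))"
    if "i \<notin> S" "j \<notin> S" for i j
    using that by (simp add: edge_binomial_def diff mult \<phi>X \<phi>Y) (simp add: algebra_simps)
  have ker: "ideal {p. \<phi> p = 0}"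
    unfolding ideal_iff using mult by (auto simp: \<phi>_def mono_map_add)
  have "?J \<subseteq> {p. \<phi> p = 0}"
  proof (rule vertex_edge_ideal_subset[OF ker])
    fix i j assume ij: "{i, j} \<in> E"
    then have "i \<notin> S" "j \<notin> S" using S by auto
    then show "edge_binomial i j \<in> {p. \<phi> p = 0}" using rep_edge[OF ij] by (simp add: \<phi>e)
  qed (simp_all add: \<phi>X \<phi>Y)
  then have "\<phi> c * \<phi> (edge_binomial u v) = 0" using c mult by auto
  moreover have "rep u \<noteq> rep v" using rep_eq uv by blast
  then have "\<phi> (edge_binomial u v) \<noteq> 0"
    using nS by (auto simp: \<phi>e mpoly_mult_eq_0_iff Var_inj)
  ultimately have "\<phi> c = 0" by (simp add: mpoly_mult_eq_0_iff)
  then have "mono_map P (clique_exponent rep) c = 0" by (simp add: \<phi>_def)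
  then show ?thesis
  proof (rule mono_map_kernel[OF ideal_vertex_edge_ideal, rotated 2])
    show "single m d - single m' d \<in> ?J" if "clique_exponent rep m = clique_exponent rep m'" for m m' d
    proof (rule clique_exponent_congruent[OF ideal_vertex_edge_ideal _ that])
      fix i j assume "i \<noteq> j" "rep i = rep j"
      then show "edge_binomial i j \<in> ?J" by (intro vertex_edge_ideal_base(3) rep_eq)
    qed
    show "single m d \<in> ?J" if nP: "\<not> P m" for m d
    proof -
      obtain i where i: "i \<in> S" "lookup m (X i) \<noteq> 0 \<or> lookup m (Y i) \<noteq> 0"
        using nP unfolding P_def by blast
      show ?thesis
        using i(2) single_in_ideal[OF ideal_vertex_edge_ideal vertex_edge_ideal_base(1)[OF i(1)]]
          single_in_ideal[OF ideal_vertex_edge_ideal vertex_edge_ideal_base(2)[OF i(1)]] by blast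
    qed
  qed
qed

text \<open>Induction along the decomposition, ordered lexicographically: deletion enlarges
  \<open>S\<close>, completion keeps \<open>S\<close> and enlarges \<open>E\<close>. The invariants
  are that \<open>V\<close> is a union of components separating \<open>u\<close> from
  \<open>v\<close>, that \<open>v\<close> is not deleted, and that the neighbours of
  \<open>v\<close> form a clique. The recursion stops when \<open>u\<close> is deleted or no vertex
  has two non-adjacent neighbours.\<close>

lemma colon_edge_binomial:
  fixes c :: "('v::finite, 'k::field) mpoly"
  assumes "simple_graph E" and "\<forall>e\<in>E. e \<inter> S = {}"
    and "\<And>a b. {a, b} \<in> E \<Longrightarrow> a \<in> V \<longleftrightarrow> b \<in> V" and "u \<in> V" "v \<notin> V" "v \<notin> S"
    and "\<And>a b. {v, a} \<in> E \<Longrightarrow> {v, b} \<in> E \<Longrightarrow> a \<noteq> b \<Longrightarrow> {a, b} \<in> E"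
    and "c * edge_binomial u v \<in> vertex_edge_ideal S E"
  shows "Var (X u) * c \<in> vertex_edge_ideal S E \<and> Var (Y u) * c \<in> vertex_edge_ideal S E"
  using assms
proof (induction "(S, E)" arbitrary: S E
    rule: wf_induct_rule[OF wf_measures[of "[\<lambda>(S, E). card (- S), \<lambda>(S, E). card (- E)]"]])
  case (1 S E)
  note prems = "1.prems"
  let ?J = "vertex_edge_ideal S E :: ('v, 'k) mpoly set"
  consider "u \<in> S"
    | "u \<notin> S" "\<And>w a b. {w, a} \<in> E \<Longrightarrow> {w, b} \<in> E \<Longrightarrow> a \<noteq> b \<Longrightarrow> {a, b} \<in> E"
    | w a b where "{w, a} \<in> E" "{w, b} \<in> E" "a \<noteq> b" "{a, b} \<notin> E"
    by blast
  then show ?case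
  proof cases
    case 1
    then show ?thesis by (auto intro!: ideal_mult_right vertex_edge_ideal_base)
  next
    case 2
    have "c \<in> ?J"
      using 2 prems(3-6) by (intro cliques_nonzerodivisor[OF prems(2) _ _ _ _ _ _ prems(8)]) blast+
    then show ?thesis by (simp add: ideal_mult)
  next
    case 3
    let ?E1 = "complete_at w E" and ?E2 = "delete_vertex w E" and ?S2 = "insert w S"
    have wS: "w \<notin> S" using prems(2) 3 by auto
    \<comment> \<open>The neighbours of \<open>v\<close> are pairwise adjacent, so the decomposition
      never takes place at \<open>v\<close>.\<close>
    have wv: "w \<noteq> v" using prems(7) 3 by blast
    have ne: "w \<noteq> a" "w \<noteq> b" using simple_graph_neq[OF prems(1)] 3 by metis+
    have E1: "E \<subset> ?E1" using 3 by (auto simp: complete_at_def)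
    have in1: "{i, j} \<in> ?E1 \<longleftrightarrow> {i, j} \<in> E \<or> i \<noteq> j \<and> {w, i} \<in> E \<and> {w, j} \<in> E" for i j
      by (auto simp: complete_at_def doubleton_eq_iff)
    have J1: "vertex_edge_ideal S E \<subseteq> (vertex_edge_ideal S ?E1 :: ('v, 'k) mpoly set)"
      using E1 by (intro vertex_edge_ideal_subset) (auto intro: vertex_edge_ideal_base)
    have J2: "vertex_edge_ideal S E \<subseteq> (vertex_edge_ideal ?S2 ?E2 :: ('v, 'k) mpoly set)"
      by (rule vertex_edge_ideal_delete)
    have "Var (X u) * c \<in> vertex_edge_ideal S ?E1 \<and> Var (Y u) * c \<in> vertex_edge_ideal S ?E1"
    proof (rule "1.hyps")
      have "card (- ?E1) < card (- E)" using E1 by (intro psubset_card_mono) auto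
      then show "((S, ?E1), (S, E)) \<in> measures [\<lambda>(S, E). card (- S), \<lambda>(S, E). card (- E)]" by simp
      show "simple_graph ?E1" using prems(1) by (auto simp: complete_at_def simple_graph_def)
      show "\<forall>e\<in>?E1. e \<inter> S = {}" using prems(2) by (auto simp: complete_at_def)
      show "i \<in> V \<longleftrightarrow> j \<in> V" if "{i, j} \<in> ?E1" for i j
        using that prems(3)[of i j] prems(3)[of w i] prems(3)[of w j] unfolding in1 by blast
      \<comment> \<open>If \<open>w\<close> is adjacent to \<open>v\<close>, all other neighbours of
        \<open>v\<close>, old and new, are neighbours of \<open>w\<close> and become pairwise
        adjacent. If not, the neighbourhood of \<open>v\<close> is unchanged.\<close>
      show "{i, j} \<in> ?E1" if "{v, i} \<in> ?E1" "{v, j} \<in> ?E1" "i \<noteq> j" for i j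
      proof (cases "{v, w} \<in> E")
        case True
        have "{w, k} \<in> E" if "{v, k} \<in> ?E1" "k \<noteq> w" for k
          using that prems(7)[of w k] True unfolding in1 by blast
        then have "i \<noteq> w \<Longrightarrow> {w, i} \<in> E" "j \<noteq> w \<Longrightarrow> {w, j} \<in> E" using that by blast+
        then show ?thesis using that(3) insert_commute[of i j "{}"] unfolding in1
          by (cases "i = w"; cases "j = w") auto
      next
        case False
        then have "{w, v} \<notin> E" by (simp add: insert_commute)
        then show ?thesis using that prems(7)[of i j] unfolding in1 by blast
      qed
      show "c * edge_binomial u v \<in> vertex_edge_ideal S ?E1" using J1 prems(8) by blast
    qed (use prems in auto)
    moreover have "Var (X u) * c \<in> vertex_edge_ideal ?S2 ?E2 \<and> Var (Y u) * c \<in> vertex_edge_ideal ?S2 ?E2"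
    proof (rule "1.hyps")
      have "card (- ?S2) < card (- S)" using wS by (intro psubset_card_mono) auto
      then show "((?S2, ?E2), (S, E)) \<in> measures [\<lambda>(S, E). card (- S), \<lambda>(S, E). card (- E)]" by simp
      show "simple_graph ?E2" using prems(1) by (auto simp: delete_vertex_def simple_graph_def)
      show "\<forall>e\<in>?E2. e \<inter> ?S2 = {}" using prems(2) by (auto simp: delete_vertex_def)
      show "i \<in> V \<longleftrightarrow> j \<in> V" if "{i, j} \<in> ?E2" for i j
        using that prems(3)[of i j] by (auto simp: delete_vertex_def)
      show "{i, j} \<in> ?E2" if "{v, i} \<in> ?E2" "{v, j} \<in> ?E2" "i \<noteq> j" for i j
        using that prems(7)[of i j] by (auto simp: delete_vertex_def)
      show "c * edge_binomial u v \<in> vertex_edge_ideal ?S2 ?E2" using J2 prems(8) by blast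
    qed (use prems wv in auto)
    ultimately show ?thesis
      using vertex_edge_ideal_decompose[OF prems(1) wS] by blast
  qed
qed

section \<open>Linear maps between free modules\<close>

lemma lookup_vec_scale [simp]: "lookup (vec_scale p w) a = p * lookup w a"
  by (auto simp: vec_scale_def Poly_Mapping.map.rep_eq when_def)

lemma module_vec_scale: "module (vec_scale :: ('v, 'k::field) mpoly \<Rightarrow> _)"
  by unfold_locales (auto intro!: poly_mapping_eqI simp: lookup_add algebra_simps)

interpretation vec: module "vec_scale :: ('v, 'k::field) mpoly \<Rightarrow> ('v, 'k) vec \<Rightarrow> ('v, 'k) vec"
  by (rule module_vec_scale)

abbreviation vec_hom :: "(('v, 'k::field) vec \<Rightarrow> ('v, 'k) vec) \<Rightarrow> bool" where
  "vec_hom \<equiv> module_hom vec_scale vec_scale"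

lemma vec_homI:
  assumes "\<And>x y. f (x + y) = f x + f y" "\<And>p x. f (vec_scale p x) = vec_scale p (f x)"
  shows "vec_hom f"
  using assms by (simp add: module_hom_iff module_vec_scale)

lemma
  assumes "vec_hom f"
  shows vec_hom_add: "f (x + y) = f x + f y"
    and vec_hom_scale: "f (vec_scale p x) = vec_scale p (f x)"
    and vec_hom_zero: "f 0 = 0"
    and vec_hom_diff: "f (x - y) = f x - f y"
    and vec_hom_sum: "f (sum g A) = (\<Sum>a\<in>A. f (g a))"
  using assms
  by (auto simp: module_hom.add module_hom.scale module_hom.zero module_hom.diff module_hom.sum)

abbreviation unit_vec :: "nat \<Rightarrow> ('v, 'k::field) vec" where
  "unit_vec a \<equiv> single a 1"

lemma vec_expand: "(\<Sum>a\<in>keys w. vec_scale (lookup w a) (unit_vec a)) = w"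
proof -
  have "vec_scale p (unit_vec a) = single a p" for p :: "('a, 'b) mpoly" and a
    by (rule poly_mapping_eqI) (simp add: lookup_single when_def)
  then show ?thesis by (simp add: poly_mapping_sum_monomials)
qed

lemma vec_hom_expand:
  assumes "vec_hom f"
  shows "f w = (\<Sum>a\<in>keys w. vec_scale (lookup w a) (f (unit_vec a)))"
  by (subst vec_expand[of w, symmetric]) (simp only: vec_hom_sum[OF assms] vec_hom_scale[OF assms])

lemma vec_hom_extend: "vec_hom (\<lambda>w. \<Sum>a\<in>keys w. vec_scale (lookup w a) (D a))"
proof (rule vec_homI)
  fix x y show "(\<Sum>a\<in>keys (x + y). vec_scale (lookup (x + y) a) (D a)) =
    (\<Sum>a\<in>keys x. vec_scale (lookup x a) (D a)) + (\<Sum>a\<in>keys y. vec_scale (lookup y a) (D a))"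
    by (rule setsum_keys_plus_distrib) (simp_all add: vec.scale_left_distrib)
next
  fix p x
  have "(\<Sum>a\<in>keys (vec_scale p x). vec_scale (lookup (vec_scale p x) a) (D a)) =
    (\<Sum>a\<in>keys x. vec_scale (p * lookup x a) (D a))"
    by (rule sum.mono_neutral_cong_left) (auto simp: in_keys_iff)
  then show "(\<Sum>a\<in>keys (vec_scale p x). vec_scale (lookup (vec_scale p x) a) (D a)) =
    vec_scale p (\<Sum>a\<in>keys x. vec_scale (lookup x a) (D a))"
    by (simp add: vec.scale_sum_right)
qed

lemma tensor_iff:
  "w \<in> tensor F L i \<longleftrightarrow> (\<forall>a. lookup w a \<in> L) \<and> (\<forall>a\<ge>rank F i. lookup w a = 0)"
  by (auto simp: tensor_def in_keys_iff) (metis not_le)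

lemma
  assumes "ideal L"
  shows tensor_add: "w \<in> tensor F L i \<Longrightarrow> w' \<in> tensor F L i \<Longrightarrow> w + w' \<in> tensor F L i"
    and tensor_diff: "w \<in> tensor F L i \<Longrightarrow> w' \<in> tensor F L i \<Longrightarrow> w - w' \<in> tensor F L i"
    and tensor_zero: "0 \<in> tensor F L i"
    and tensor_scale: "w \<in> tensor F L i \<Longrightarrow> vec_scale p w \<in> tensor F L i"
  using assms
  by (auto simp: tensor_iff lookup_add lookup_minus ideal_add ideal_diff ideal_zero ideal_mult)

lemma tensor_mono: "L \<subseteq> L' \<Longrightarrow> tensor F L i \<subseteq> tensor F L' i"
  unfolding tensor_iff subset_iff by blast

lemma unit_vec_tensor: "a < rank F i \<Longrightarrow> unit_vec a \<in> tensor F UNIV i"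
  by (auto simp: tensor_iff lookup_single when_def)

text \<open>The entries of \<open>f w\<close> are linear combinations of the entries of
  \<open>w\<close>. Hence a linear map between the free modules restricts to the tensor products
  with any ideal, which later lets homotopies pass from \<open>F\<close> to
  \<open>F \<otimes> L\<close>.\<close>

lemma tensor_hom_image:
  assumes L: "ideal L" and f: "vec_hom f" and T: "f ` tensor F UNIV i \<subseteq> tensor F UNIV i'"
    and w: "w \<in> tensor F L i"
  shows "f w \<in> tensor F L i'"
proof -
  have "lookup (f w) b \<in> L" for b
    unfolding vec_hom_expand[OF f, of w] lookup_sum
    using w by (intro ideal_sum[OF L]) (auto simp: tensor_iff intro: ideal_mult_right[OF L])
  moreover have "f w \<in> tensor F UNIV i'" using T w tensor_mono[of L UNIV] by blast
  ultimately show ?thesis by (simp add: tensor_iff)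
qed

text \<open>In homological degree 0 everything is a cycle: the complexes are tensored without the
  augmentation.\<close>

definition chain_cycle :: "('v, 'k::field) free_complex \<Rightarrow> nat \<Rightarrow> ('v, 'k) vec \<Rightarrow> bool" where
  "chain_cycle F i w \<longleftrightarrow> (\<forall>l. i = Suc l \<longrightarrow> diff F l w = 0)"

lemma chain_cycle_simps [simp]:
  "chain_cycle F 0 w" "chain_cycle F (Suc i) w \<longleftrightarrow> diff F i w = 0"
  by (simp_all add: chain_cycle_def)

lemma lookup_Var_0 [simp]: "lookup (Var z) 0 = 0"
proof -
  have "lookup (single z (1::nat)) z \<noteq> lookup 0 z" by simp
  then have "single z (1::nat) \<noteq> 0" by metis
  then show ?thesis by (simp add: Var_def lookup_single when_def)
qed

section \<open>Multiplication by a variable is null-homotopic\<close>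

locale residue_resolution =
  fixes F :: "('v::finite, 'k::field) free_complex" and \<epsilon> :: "('v, 'k) vec \<Rightarrow> 'k"
  assumes diff_hom: "vec_hom (diff F i)"
    and diff_piece: "diff F i ` tensor_piece F UNIV (Suc i) j \<subseteq> tensor_piece F UNIV i j"
    and exact_Suc: "diff F (Suc i) ` tensor F UNIV (Suc (Suc i)) =
      {w \<in> tensor F UNIV (Suc i). diff F i w = 0}"
    and eps_hom: "module_hom vec_scale residue_scale \<epsilon>"
    and exact_0: "diff F 0 ` tensor F UNIV (Suc 0) = {w \<in> tensor F UNIV 0. \<epsilon> w = 0}"
begin

lemmas diff_add = vec_hom_add[OF diff_hom] and diff_scale = vec_hom_scale[OF diff_hom]
  and diff_zero = vec_hom_zero[OF diff_hom] and diff_diff = vec_hom_diff[OF diff_hom]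
  and diff_sum = vec_hom_sum[OF diff_hom]

lemma diff_tensor_UNIV: "diff F i ` tensor F UNIV (Suc i) \<subseteq> tensor F UNIV i"
  using exact_0 exact_Suc by (cases i) auto

lemma diff_tensor: "ideal L \<Longrightarrow> w \<in> tensor F L (Suc i) \<Longrightarrow> diff F i w \<in> tensor F L i"
  by (rule tensor_hom_image[OF _ diff_hom diff_tensor_UNIV])

lemma chain_cycle_diff: "w \<in> tensor F UNIV (Suc i) \<Longrightarrow> chain_cycle F i (diff F i w)"
  using exact_Suc by (cases i) auto

lemma chain_cycle_scale: "chain_cycle F i w \<Longrightarrow> chain_cycle F i (vec_scale p w)"
  by (cases i) (auto simp: diff_scale)

lemma eps_scale: "\<epsilon> (vec_scale p w) = lookup p 0 * \<epsilon> w"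
  using module_hom.scale[OF eps_hom] by (simp add: residue_scale_def)

lemma eps_zero_constant_coeffs:
  assumes "\<And>a. lookup (lookup w a) 0 = 0"
  shows "\<epsilon> w = 0"
  by (subst vec_expand[of w, symmetric]) (simp add: module_hom.sum[OF eps_hom] eps_scale assms)

text \<open>Freeness of \<open>F_i\<close>: preimages are chosen for the basis vectors and extended
  linearly.\<close>

lemma lift_through_diff:
  assumes g: "vec_hom g" and im: "\<And>a. a < rank F i \<Longrightarrow> g (unit_vec a) \<in> diff F i ` tensor F UNIV (Suc i)"
  obtains s where "vec_hom s" "s ` tensor F UNIV i \<subseteq> tensor F UNIV (Suc i)"
    "\<And>w. w \<in> tensor F UNIV i \<Longrightarrow> diff F i (s w) = g w"
proof -
  have "\<forall>a. \<exists>y. a < rank F i \<longrightarrow> y \<in> tensor F UNIV (Suc i) \<and> diff F i y = g (unit_vec a)"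
    using im by force
  then obtain D where D: "\<And>a. a < rank F i \<Longrightarrow> D a \<in> tensor F UNIV (Suc i)"
      "\<And>a. a < rank F i \<Longrightarrow> diff F i (D a) = g (unit_vec a)"
    by metis
  define s where "s w = (\<Sum>a\<in>keys w. vec_scale (lookup w a) (D a))" for w
  have s: "vec_hom s" unfolding s_def by (rule vec_hom_extend)
  moreover have "s w \<in> tensor F UNIV (Suc i)" if "w \<in> tensor F UNIV i" for w
  proof -
    have "finite A \<Longrightarrow> A \<subseteq> keys w \<Longrightarrow> (\<Sum>a\<in>A. vec_scale (lookup w a) (D a)) \<in> tensor F UNIV (Suc i)" for A
    proof (induction A rule: finite_induct)
      case (insert a A)
      then have "a < rank F i" using that by (auto simp: tensor_def)
      then show ?case using insert D(1) by (simp add: tensor_add tensor_scale)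
    qed (simp add: tensor_zero)
    then show ?thesis by (simp add: s_def)
  qed
  moreover have "diff F i (s w) = g w" if "w \<in> tensor F UNIV i" for w
  proof -
    have "diff F i (s w) = (\<Sum>a\<in>keys w. vec_scale (lookup w a) (diff F i (D a)))"
      by (simp add: s_def diff_sum diff_scale)
    also have "\<dots> = (\<Sum>a\<in>keys w. vec_scale (lookup w a) (g (unit_vec a)))"
      using that D(2) by (intro sum.cong) (auto simp: tensor_def)
    also have "\<dots> = g w" using vec_hom_expand[OF g, of w] by simp
    finally show ?thesis .
  qed
  ultimately show ?thesis using that by blast
qed

text \<open>A variable acts as zero on \<open>k\<close>, so multiplication by it lifts the zero map
  and has a homotopy with \<open>d s + s d = z\<close>. Only the equation on cycles is recorded,
  where \<open>s d\<close> vanishes; the inductive construction asks for no more.\<close>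

lemma Var_null_homotopy:
  "\<exists>s. vec_hom s \<and> s ` tensor F UNIV i \<subseteq> tensor F UNIV (Suc i) \<and>
    (\<forall>w\<in>tensor F UNIV i. chain_cycle F i w \<longrightarrow> diff F i (s w) = vec_scale (Var z) w)"
proof (induction i)
  case 0
  have "vec_hom (vec_scale (Var z) :: ('v, 'k) vec \<Rightarrow> _)"
    by (rule vec_homI) (auto simp: vec.scale_right_distrib mult.commute)
  moreover have "vec_scale (Var z) (unit_vec a) \<in> diff F 0 ` tensor F UNIV (Suc 0)" if "a < rank F 0" for a
    using that tensor_scale[OF ideal_UNIV unit_vec_tensor]
    by (auto simp: exact_0 eps_scale)
  ultimately obtain s where "vec_hom s" "s ` tensor F UNIV 0 \<subseteq> tensor F UNIV (Suc 0)"
    "\<And>w. w \<in> tensor F UNIV 0 \<Longrightarrow> diff F 0 (s w) = vec_scale (Var z) w"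
    using lift_through_diff by blast
  then show ?case by blast
next
  case (Suc i)
  then obtain s where s: "vec_hom s" "s ` tensor F UNIV i \<subseteq> tensor F UNIV (Suc i)"
    "\<And>w. w \<in> tensor F UNIV i \<Longrightarrow> chain_cycle F i w \<Longrightarrow> diff F i (s w) = vec_scale (Var z) w"
    by blast
  \<comment> \<open>The equation \<open>d s' = z - s d\<close> has to be solved for
    \<open>s'\<close> on a basis. The right-hand side is a cycle there, because
    \<open>d s = z\<close> already holds on the cycle \<open>d e\<close>; exactness of
    \<open>F\<close> then supplies preimages.\<close>
  let ?g = "\<lambda>w. vec_scale (Var z) w - s (diff F i w)"
  have "vec_hom ?g"
    by (rule vec_homI) (simp_all add: vec_hom_add[OF s(1)] vec_hom_scale[OF s(1)] diff_add diff_scale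
      vec.scale_right_distrib vec.scale_right_diff_distrib mult.commute)
  moreover have "?g (unit_vec a) \<in> diff F (Suc i) ` tensor F UNIV (Suc (Suc i))"
    if "a < rank F (Suc i)" for a
  proof -
    let ?e = "unit_vec a :: ('v, 'k) vec"
    have e: "?e \<in> tensor F UNIV (Suc i)" using that by (rule unit_vec_tensor)
    then have de: "diff F i ?e \<in> tensor F UNIV i" by (simp add: diff_tensor)
    have "diff F i (?g ?e) = 0"
      using s(3)[OF de chain_cycle_diff[OF e]] by (simp add: diff_diff diff_scale)
    moreover have "?g ?e \<in> tensor F UNIV (Suc i)"
      using e de s(2) by (intro tensor_diff tensor_scale) auto
    ultimately show ?thesis by (simp add: exact_Suc)
  qed
  ultimately obtain s' where s': "vec_hom s'"
    "s' ` tensor F UNIV (Suc i) \<subseteq> tensor F UNIV (Suc (Suc i))"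
    "\<And>w. w \<in> tensor F UNIV (Suc i) \<Longrightarrow> diff F (Suc i) (s' w) = ?g w"
    using lift_through_diff by blast
  then show ?case by (auto simp: vec_hom_zero[OF s(1)])
qed

lemma Var_kills_homology:
  assumes L: "ideal L" and w: "w \<in> tensor F L i" "chain_cycle F i w"
  shows "vec_scale (Var z) w \<in> diff F i ` tensor F L (Suc i)"
proof -
  obtain s where s: "vec_hom s" "s ` tensor F UNIV i \<subseteq> tensor F UNIV (Suc i)"
    "\<And>w. w \<in> tensor F UNIV i \<Longrightarrow> chain_cycle F i w \<Longrightarrow> diff F i (s w) = vec_scale (Var z) w"
    using Var_null_homotopy[of i z] by blast
  have "s w \<in> tensor F L (Suc i)" by (rule tensor_hom_image[OF L s(1,2) w(1)])
  moreover have "diff F i (s w) = vec_scale (Var z) w"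
    using s(3) w tensor_mono[of L UNIV] by blast
  ultimately show ?thesis by (metis imageI)
qed

text \<open>If \<open>c f \<in> J\<close> forces \<open>x\<^sub>u c, y\<^sub>u c \<in> J\<close>, then multiplication by
  \<open>f = y\<^sub>v x\<^sub>u - x\<^sub>v y\<^sub>u\<close> from \<open>J : f\<close> to \<open>J\<close> is a combination, with
  coefficients in the maximal ideal, of two well-defined linear maps.\<close>

lemma cycle_in_intersection:
  assumes J: "ideal J"
    and colon: "\<And>c. c * edge_binomial u v \<in> J \<Longrightarrow> Var (X u) * c \<in> J \<and> Var (Y u) * c \<in> J"
    and const: "\<And>c. c * edge_binomial u v \<in> J \<Longrightarrow> lookup c 0 = 0"
    and uv: "edge_binomial u v \<noteq> (0 :: ('v, 'k) mpoly)"
    and w: "w \<in> tensor F (J \<inter> ideal_generated {edge_binomial u v}) i" "chain_cycle F i w"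
  shows "w \<in> diff F i ` tensor F J (Suc i)"
    and "w \<in> diff F i ` tensor F (ideal_generated {edge_binomial u v}) (Suc i)"
proof -
  let ?f = "edge_binomial u v :: ('v, 'k) mpoly"
  have "\<forall>a. \<exists>c. lookup w a = c * ?f"
    using w(1) by (auto simp: tensor_iff ideal_generated_singleton)
  then obtain c where c: "\<And>a. lookup w a = c a * ?f" by metis
  have c0: "c a \<noteq> 0 \<longleftrightarrow> a \<in> keys w" for a
    by (simp add: in_keys_iff c uv mpoly_mult_eq_0_iff)
  define g where "g = Abs_poly_mapping c"
  have lookup_g: "lookup g = c" unfolding g_def by (rule lookup_Abs_poly_mapping) (simp add: c0)
  have w_eq: "w = vec_scale ?f g"
    by (rule poly_mapping_eqI) (simp add: lookup_g c mult.commute)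
  have g_zero: "lookup g a = 0" if "rank F i \<le> a" for a
    using c0[of a] w(1) that by (auto simp: lookup_g tensor_iff in_keys_iff)
  have cJ: "c a * ?f \<in> J" for a using w(1) c[of a] by (metis IntD1 tensor_iff)
  have gT: "g \<in> tensor F UNIV i" using g_zero by (simp add: tensor_iff)
  \<comment> \<open>\<open>f\<close> is a nonzerodivisor, so dividing the entries of
    \<open>w\<close> by it preserves cycles.\<close>
  have g_cycle: "chain_cycle F i g"
  proof (cases i)
    case (Suc l)
    then have "vec_scale ?f (diff F l g) = 0" using w(2) by (simp add: w_eq diff_scale)
    then have "lookup (vec_scale ?f (diff F l g)) a = 0" for a by simp
    then have "diff F l g = 0" using uv by (intro poly_mapping_eqI) (simp add: mpoly_mult_eq_0_iff)
    then show ?thesis using Suc by simp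
  qed simp
  have "vec_scale (Var (X u)) g \<in> tensor F J i" "vec_scale (Var (Y u)) g \<in> tensor F J i"
    using colon[OF cJ] g_zero by (auto simp: tensor_iff lookup_g)
  then obtain y1 y2 where y: "y1 \<in> tensor F J (Suc i)" "y2 \<in> tensor F J (Suc i)"
    "diff F i y1 = vec_scale (Var (Y v)) (vec_scale (Var (X u)) g)"
    "diff F i y2 = vec_scale (Var (X v)) (vec_scale (Var (Y u)) g)"
    using Var_kills_homology[OF J _ chain_cycle_scale[OF g_cycle]] by (smt (verit) imageE)
  have "w = diff F i (y1 - y2)"
    by (simp add: diff_diff y w_eq edge_binomial_def vec.scale_left_diff_distrib mult.commute)
  then show "w \<in> diff F i ` tensor F J (Suc i)" using tensor_diff[OF J y(1,2)] by blast
  \<comment> \<open>Without the condition that entries lie in an ideal, \<open>g\<close> is a cycle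
    of the resolution itself: exactness applies for \<open>i > 0\<close>, and for
    \<open>i = 0\<close> the augmentation kills \<open>g\<close> since its entries have no constant
    term. Multiplying a preimage by \<open>f\<close> puts its entries into the principal
    ideal.\<close>
  have "g \<in> diff F i ` tensor F UNIV (Suc i)"
  proof (cases i)
    case 0
    have "\<epsilon> g = 0" by (rule eps_zero_constant_coeffs) (simp add: lookup_g const[OF cJ])
    then show ?thesis using gT 0 by (simp add: exact_0)
  next
    case (Suc l)
    then show ?thesis using gT g_cycle by (simp add: exact_Suc)
  qed
  then obtain y where y: "y \<in> tensor F UNIV (Suc i)" "g = diff F i y" by blast
  then have "w = diff F i (vec_scale ?f y)" by (simp add: w_eq diff_scale)
  moreover have "vec_scale ?f y \<in> tensor F (ideal_generated {?f}) (Suc i)"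
    using y(1) ideal_mult_right[OF ideal_ideal_generated ideal_generated_base, of ?f "{?f}"]
    by (simp add: tensor_iff)
  ultimately show "w \<in> diff F i ` tensor F (ideal_generated {?f}) (Suc i)" by blast
qed

end

section \<open>Dimensions of quotient spaces\<close>

locale quotient_space = V: vector_space scale
  for scale :: "'a::field \<Rightarrow> 'b::ab_group_add \<Rightarrow> 'b"
begin

definition lin_comb :: "('b \<Rightarrow>\<^sub>0 'a) \<Rightarrow> 'b" where
  "lin_comb c = (\<Sum>s\<in>keys c. scale (lookup c s) s)"

lemma lin_comb_add: "lin_comb (c + c') = lin_comb c + lin_comb c'"
  unfolding lin_comb_def
  by (rule setsum_keys_plus_distrib) (simp_all add: V.scale_left_distrib)

lemma lin_comb_0 [simp]: "lin_comb 0 = 0"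
  by (simp add: lin_comb_def)

lemma lin_comb_diff: "lin_comb (c - c') = lin_comb c - lin_comb c'"
  using lin_comb_add[of "c - c'" c'] by (simp add: algebra_simps)

lemma lin_comb_single: "lin_comb (single s a) = scale a s"
  by (simp add: lin_comb_def)

lemma lin_comb_in_span: "keys c \<subseteq> S \<Longrightarrow> lin_comb c \<in> V.span S"
  unfolding lin_comb_def by (rule V.span_sum) (auto intro: V.span_scale V.span_base)

lemma span_lin_comb:
  assumes "x \<in> V.span S"
  obtains c where "keys c \<subseteq> S" "x = lin_comb c"
proof -
  have "\<exists>c. keys c \<subseteq> S \<and> x = lin_comb c"
    using assms
  proof (induction rule: V.span_induct_alt)
    case base
    show ?case by (intro exI[of _ 0]) simp
  next
    case (step a s y)
    then obtain c where c: "keys c \<subseteq> S" "y = lin_comb c" by blast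
    have "keys (single s a + c) \<subseteq> S" using keys_add[of "single s a" c] step(1) c(1)
      by (auto split: if_splits)
    moreover have "scale a s + y = lin_comb (single s a + c)"
      by (simp only: lin_comb_add lin_comb_single c)
    ultimately show ?case by blast
  qed
  then show ?thesis using that by blast
qed

text \<open>Existence of coefficients means spanning modulo \<open>B\<close>; uniqueness, by taking
  differences, means that only the zero combination falls into \<open>B\<close>.\<close>

lemma quotient_basis_iff:
  assumes "V.subspace Z" "V.subspace B"
  shows "quotient_basis scale Z B S \<longleftrightarrow> S \<subseteq> Z \<and>
    (\<forall>z\<in>Z. \<exists>x\<in>V.span S. z - x \<in> B) \<and> (\<forall>c. keys c \<subseteq> S \<longrightarrow> lin_comb c \<in> B \<longrightarrow> c = 0)"
    (is "?l \<longleftrightarrow> ?r")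
proof
  assume l: ?l
  then have S: "S \<subseteq> Z"
    and ex: "\<And>z. z \<in> Z \<Longrightarrow> \<exists>!c. keys c \<subseteq> S \<and> z - lin_comb c \<in> B"
    unfolding quotient_basis_def lin_comb_def by blast+
  have "\<exists>x\<in>V.span S. z - x \<in> B" if "z \<in> Z" for z
    using ex[OF that] lin_comb_in_span by blast
  moreover have "c = 0" if c: "keys c \<subseteq> S" "lin_comb c \<in> B" for c
  proof -
    have "lin_comb c \<in> Z"
      using lin_comb_in_span[OF c(1)] V.span_minimal[OF S assms(1)] by blast
    moreover have "keys 0 \<subseteq> S \<and> lin_comb c - lin_comb 0 \<in> B" using c by simp
    moreover have "keys c \<subseteq> S \<and> lin_comb c - lin_comb c \<in> B"
      using c V.subspace_0[OF assms(2)] by simp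
    ultimately show "c = 0" using ex by blast
  qed
  ultimately show ?r using S by blast
next
  assume r: ?r
  have "\<exists>!c. keys c \<subseteq> S \<and> z - lin_comb c \<in> B" if z: "z \<in> Z" for z
  proof -
    obtain x where x: "x \<in> V.span S" "z - x \<in> B" using r z by blast
    then obtain c where "keys c \<subseteq> S" "x = lin_comb c" using span_lin_comb by metis
    then have "keys c \<subseteq> S \<and> z - lin_comb c \<in> B" using x by simp
    moreover have "c = c'" if c: "keys c \<subseteq> S \<and> z - lin_comb c \<in> B"
      "keys c' \<subseteq> S \<and> z - lin_comb c' \<in> B" for c c'
    proof -
      have "keys (c - c') \<subseteq> S" using keys_diff[of c c'] c by blast
      moreover have "lin_comb (c - c') \<in> B"
        using V.subspace_diff[OF assms(2), of "z - lin_comb c'" "z - lin_comb c"] c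
        by (simp add: lin_comb_diff)
      ultimately show ?thesis using r by (metis eq_iff_diff_eq_0)
    qed
    ultimately show ?thesis by blast
  qed
  then show ?l using r unfolding quotient_basis_def lin_comb_def[symmetric] by simp
qed

text \<open>A basis of \<open>B\<close> is extended to a basis of \<open>Z\<close>; the added
  vectors represent a basis of the quotient.\<close>

lemma quotient_basis_exists:
  assumes Z: "V.subspace Z" and B: "V.subspace B" "B \<subseteq> Z"
  shows "\<exists>S. quotient_basis scale Z B S"
proof -
  obtain b where b: "b \<subseteq> B" "V.independent b" "B \<subseteq> V.span b"
    using V.maximal_independent_subset by blast
  obtain D where D: "b \<subseteq> D" "D \<subseteq> Z" "V.independent D" "Z \<subseteq> V.span D"
    using V.maximal_independent_subset_extend[of b Z] b B by blast
  have spb: "V.span b = B" using b B by (simp add: V.span_subspace)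
  have "\<exists>x\<in>V.span (D - b). z - x \<in> B" if "z \<in> Z" for z
  proof -
    have "z \<in> V.span ((D - b) \<union> b)" using D that by (metis Un_Diff_cancel2 Un_absorb2 subsetD)
    then show ?thesis unfolding V.span_Un spb by force
  qed
  moreover have "c = 0" if c: "keys c \<subseteq> D - b" "lin_comb c \<in> B" for c
  proof (rule ccontr)
    assume "c \<noteq> 0"
    then obtain s where s: "s \<in> keys c" by (metis keys_eq_empty ex_in_conv)
    let ?r = "\<Sum>t\<in>keys c - {s}. scale (lookup c t) t"
    have "lin_comb c = scale (lookup c s) s + ?r"
      using s by (simp add: lin_comb_def sum.remove)
    moreover have "?r \<in> V.span (D - {s})"
      using c(1) by (intro V.span_sum V.span_scale V.span_base) auto
    moreover have "lin_comb c \<in> V.span (D - {s})"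
      using c s D(1) V.span_mono[of b "D - {s}"] spb by blast
    ultimately have "scale (lookup c s) s \<in> V.span (D - {s})"
      using V.span_diff[of "lin_comb c" "D - {s}" ?r] by simp
    then have "s \<in> V.span (D - {s})"
      using V.span_scale[of "scale (lookup c s) s" "D - {s}" "inverse (lookup c s)"] s
      by (simp add: in_keys_iff)
    then show False using D(3) s c(1) by (auto simp: V.dependent_def)
  qed
  ultimately have "quotient_basis scale Z B (D - b)"
    unfolding quotient_basis_iff[OF Z B(1)] using D by blast
  then show ?thesis ..
qed

text \<open>Together with a basis of \<open>B\<close>, \<open>S\<close> forms a basis of
  \<open>Z\<close>. So all choices of \<open>S\<close> have the same size, and the choice inside
  \<open>quotient_dim\<close> is harmless in finite dimension.\<close>

lemma quotient_basis_card:
  assumes Z: "V.subspace Z" and B: "V.subspace B" "B \<subseteq> Z" and fin: "Z \<subseteq> V.span T" "finite T"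
    and S: "quotient_basis scale Z B S"
  shows "V.dim Z = V.dim B + card S" and "V.independent S"
proof -
  obtain b where b: "b \<subseteq> B" "V.independent b" "B \<subseteq> V.span b" "card b = V.dim B"
    using V.basis_exists by metis
  have spb: "V.span b = B" using b B by (simp add: V.span_subspace)
  note S = S[unfolded quotient_basis_iff[OF Z B(1)]]
  have SZ: "S \<subseteq> Z" using S by blast
  have disj: "s \<notin> B" if "s \<in> S" for s
  proof
    assume "s \<in> B"
    then have "lin_comb (single s 1) \<in> B" "keys (single s (1::'a)) \<subseteq> S"
      using that by (simp_all add: lin_comb_single)
    then have "single s (1::'a) = 0" using S by blast
    then have "lookup (single s (1::'a)) s = 0" by simp
    then show False by simp
  qed
  have ind: "V.independent (S \<union> b)"
  proof
    assume "V.dependent (S \<union> b)"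
    then obtain a where a: "a \<in> S \<union> b" "a \<in> V.span (S \<union> b - {a})" by (auto simp: V.dependent_def)
    show False
    proof (cases "a \<in> S")
      case True
      then have "S \<union> b - {a} \<subseteq> (S - {a}) \<union> b" by blast
      then have "a \<in> V.span ((S - {a}) \<union> b)" using a(2) V.span_mono by blast
      then obtain x y where xy: "a = x + y" "x \<in> V.span (S - {a})" "y \<in> B"
        unfolding V.span_Un spb by blast
      then obtain c where c: "keys c \<subseteq> S - {a}" "x = lin_comb c" using span_lin_comb by metis
      have "lin_comb (single a 1 - c) = y"
        unfolding lin_comb_diff lin_comb_single c(2)[symmetric] using xy(1) by simp
      then have "lin_comb (single a 1 - c) \<in> B" using xy(3) by simp
      moreover have "keys (single a 1 - c) \<subseteq> S"
        using keys_diff[of "single a 1" c] c True by auto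
      ultimately have "single a 1 - c = 0" using S by blast
      then have "c = single a 1" by simp
      then have "a \<in> keys c" by simp
      then show False using c by blast
    next
      case False
      then have "S \<union> b - {a} \<subseteq> S \<union> (b - {a})" by blast
      then have "a \<in> V.span (S \<union> (b - {a}))" using a(2) V.span_mono by blast
      then obtain x y where xy: "a = x + y" "x \<in> V.span S" "y \<in> V.span (b - {a})"
        unfolding V.span_Un by blast
      then obtain c where c: "keys c \<subseteq> S" "x = lin_comb c" using span_lin_comb by metis
      have "y \<in> B" using xy(3) V.span_mono[of "b - {a}" b] spb by blast
      moreover have "a \<in> B" using False a b by blast
      ultimately have "x \<in> B" using V.subspace_diff[OF B(1), of a y] xy by simp
      then have "c = 0" using S c by blast
      then show False using xy c False a b(2) by (auto simp: V.dependent_def)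
    qed
  qed
  have finite: "finite (S \<union> b)"
  proof -
    have "S \<union> b \<subseteq> V.span T" using SZ b(1) B(2) fin(1) by blast
    then show ?thesis using V.independent_span_bound[OF fin(2) ind] by blast
  qed
  have "Z \<subseteq> V.span (S \<union> b)"
  proof
    fix z assume "z \<in> Z"
    then obtain x where "x \<in> V.span S" "z - x \<in> B" using S by blast
    then show "z \<in> V.span (S \<union> b)" unfolding V.span_Un spb by force
  qed
  then have "card (S \<union> b) = V.dim Z"
    using SZ b(1) B(2) by (intro V.basis_card_eq_dim ind) auto
  moreover have "S \<inter> b = {}" using disj b by blast
  ultimately show "V.dim Z = V.dim B + card S" using finite b(4) by (simp add: card_Un_disjoint)
  show "V.independent S" using ind by (rule V.independent_mono) blast
qed

lemma quotient_dim_eq: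
  assumes "V.subspace Z" "V.subspace B" "B \<subseteq> Z" "Z \<subseteq> V.span T" "finite T"
  shows "V.dim Z = V.dim B + quotient_dim scale Z B"
  unfolding quotient_dim_def
  by (rule quotient_basis_card(1)[OF assms]) (rule someI_ex[OF quotient_basis_exists[OF assms(1-3)]])

text \<open>Second isomorphism theorem: representatives of a basis of \<open>A\<close> modulo
  \<open>A \<inter> B\<close> also represent a basis of \<open>A + B\<close> modulo
  \<open>B\<close>.\<close>

lemma dim_sum_Int:
  assumes A: "V.subspace A" and B: "V.subspace B" and C: "{a + b | a b. a \<in> A \<and> b \<in> B} \<subseteq> V.span T" "finite T"
  shows "V.dim {a + b | a b. a \<in> A \<and> b \<in> B} + V.dim (A \<inter> B) = V.dim A + V.dim B"
proof -
  let ?C = "{a + b | a b. a \<in> A \<and> b \<in> B}"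
  have spC: "V.subspace ?C" using V.subspace_sums[OF A B] .
  have AC: "A \<subseteq> ?C" using V.subspace_0[OF B] by force
  have BC: "B \<subseteq> ?C" using V.subspace_0[OF A] by force
  have AB: "V.subspace (A \<inter> B)" by (rule V.subspace_inter[OF A B])
  obtain S where S: "quotient_basis scale A (A \<inter> B) S"
    using quotient_basis_exists[OF A AB] by blast
  note S' = S[unfolded quotient_basis_iff[OF A AB]]
  have "quotient_basis scale ?C B S"
    unfolding quotient_basis_iff[OF spC B]
  proof (intro conjI ballI allI impI)
    show "S \<subseteq> ?C" using S' AC by blast
    fix z assume "z \<in> ?C"
    then obtain a b where ab: "z = a + b" "a \<in> A" "b \<in> B" by blast
    then obtain x where x: "x \<in> V.span S" "a - x \<in> B" using S' by blast
    then show "\<exists>x\<in>V.span S. z - x \<in> B"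
      using ab V.subspace_add[OF B x(2) ab(3)] by (intro bexI[of _ x]) (simp_all add: algebra_simps)
  next
    fix c assume c: "keys c \<subseteq> S" "lin_comb c \<in> B"
    then have "lin_comb c \<in> A" using lin_comb_in_span[of c S] V.span_minimal[OF _ A] S' by blast
    then show "c = 0" using S' c by blast
  qed
  then have "V.dim ?C = V.dim B + card S"
    using quotient_basis_card(1)[OF spC B BC C] by blast
  moreover have "V.dim A = V.dim (A \<inter> B) + card S"
    using quotient_basis_card(1)[OF A AB _ _ C(2) S] AC C by blast
  ultimately show ?thesis by simp
qed

text \<open>Rank-nullity on a finite-dimensional subspace: \<open>f\<close> is injective on the span
  of representatives of a basis modulo the kernel.\<close>

lemma dim_kernel_image:
  assumes f: "Vector_Spaces.linear scale scale f" and W: "V.subspace W" "W \<subseteq> V.span T" "finite T"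
  shows "V.dim W = V.dim {w \<in> W. f w = 0} + V.dim (f ` W)"
proof -
  interpret f: Vector_Spaces.linear scale scale f by (rule f)
  let ?K = "{w \<in> W. f w = 0}"
  have K: "V.subspace ?K" "?K \<subseteq> W"
    using V.subspace_inter[OF W(1) f.subspace_kernel] by (auto simp: Int_def)
  obtain S where S: "quotient_basis scale W ?K S" using quotient_basis_exists[OF W(1) K] by blast
  note S' = S[unfolded quotient_basis_iff[OF W(1) K(1)]]
  have SW: "V.span S \<subseteq> W" using S' by (intro V.span_minimal W(1)) blast
  have inj: "inj_on f (V.span S)"
  proof (rule inj_onI)
    fix x y assume xy: "x \<in> V.span S" "y \<in> V.span S" "f x = f y"
    then have "x - y \<in> V.span S" by (simp add: V.span_diff)
    then obtain c where c: "keys c \<subseteq> S" "x - y = lin_comb c" using span_lin_comb by metis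
    have "lin_comb c \<in> ?K"
      using c \<open>x - y \<in> V.span S\<close> SW xy(3) f.diff[of x y] by auto
    then have "c = 0" using S' c by blast
    then show "x = y" using c by simp
  qed
  have "f ` W \<subseteq> V.span (f ` S)"
  proof
    fix y assume "y \<in> f ` W"
    then obtain w where w: "w \<in> W" "y = f w" by blast
    then obtain x where x: "x \<in> V.span S" "w - x \<in> ?K" using S' by blast
    then have "y = f x" using w f.diff[of w x] by simp
    then show "y \<in> V.span (f ` S)" using x by (simp add: f.span_image)
  qed
  moreover have "V.independent (f ` S)"
    using f.independent_injective_image[OF quotient_basis_card(2)[OF W(1) K W(2,3) S] inj] .
  moreover have "f ` S \<subseteq> f ` W" using S' by blast
  ultimately have "card (f ` S) = V.dim (f ` W)" by (intro V.basis_card_eq_dim)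
  moreover have "card (f ` S) = card S"
    using inj V.span_superset by (intro card_image) (auto intro: inj_on_subset)
  ultimately show ?thesis using quotient_basis_card(1)[OF W(1) K W(2,3) S] by simp
qed

end

section \<open>Homogeneous components\<close>

lemma monomial_degree_sum: "monomial_degree (m :: 'v::finite monomial) = (\<Sum>z\<in>UNIV. lookup m z)"
  unfolding monomial_degree_def by (rule sum.mono_neutral_left) (auto simp: in_keys_iff)

lemma monomial_degree_add:
  "monomial_degree (m + m' :: 'v::finite monomial) = monomial_degree m + monomial_degree m'"
  by (simp add: monomial_degree_sum lookup_add sum.distrib)

lemma monomial_degree_zero [simp]: "monomial_degree 0 = 0"
  by (simp add: monomial_degree_def)

lemma finite_monomials_of_degree: "finite {m :: 'v::finite monomial. int (monomial_degree m) = d}"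
proof (rule finite_imageD)
  have "finite (Pi\<^sub>E (UNIV :: 'v var set) (\<lambda>_. {..nat d}))" by (rule finite_PiE) auto
  moreover have "lookup ` {m :: 'v monomial. int (monomial_degree m) = d} \<subseteq> Pi\<^sub>E UNIV (\<lambda>_. {..nat d})"
  proof (clarsimp simp: PiE_def)
    fix m :: "'v monomial" and z
    have "lookup m z \<le> (\<Sum>z\<in>UNIV. lookup m z)" by (rule member_le_sum) auto
    then show "lookup m z \<le> monomial_degree m" by (simp add: monomial_degree_sum)
  qed
  ultimately show "finite (lookup ` {m :: 'v monomial. int (monomial_degree m) = d})"
    by (rule finite_subset[rotated])
  show "inj_on lookup {m :: 'v monomial. int (monomial_degree m) = d}"
    by (intro inj_onI poly_mapping_eqI) simp
qed

definition hom_comp :: "int \<Rightarrow> ('v, 'k::field) mpoly \<Rightarrow> ('v, 'k) mpoly" where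
  "hom_comp d = mono_map (\<lambda>m. int (monomial_degree m) = d) (\<lambda>m. m)"

lemma lookup_hom_comp:
  "lookup (hom_comp d p) m = (if int (monomial_degree m) = d then lookup p m else 0)"
  by (simp add: hom_comp_def lookup_mono_map_id)

lemma hom_comp_add: "hom_comp d (p + q) = hom_comp d p + hom_comp d q"
  by (simp add: hom_comp_def mono_map_add)

lemma hom_comp_zero [simp]: "hom_comp d 0 = 0"
  by (simp add: hom_comp_def)

lemma homogeneous_iff_hom_comp: "homogeneous_of_degree d p \<longleftrightarrow> hom_comp d p = p"
  by (auto simp: homogeneous_of_degree_def poly_mapping_eq_iff fun_eq_iff lookup_hom_comp in_keys_iff)

lemma hom_comp_hom_comp: "hom_comp d (hom_comp d' p) = (if d = d' then hom_comp d p else 0)"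
  by (rule poly_mapping_eqI) (auto simp: lookup_hom_comp)

lemma hom_comp_homogeneous:
  "homogeneous_of_degree d p \<Longrightarrow> hom_comp d' p = (if d' = d then p else 0)"
  by (metis hom_comp_hom_comp homogeneous_iff_hom_comp)

lemma homogeneous_mult:
  fixes p q :: "('v::finite, 'k::field) mpoly"
  assumes "homogeneous_of_degree d p" "homogeneous_of_degree e q"
  shows "homogeneous_of_degree (d + e) (p * q)"
  unfolding homogeneous_of_degree_def
proof
  fix m assume "m \<in> keys (p * q)"
  then obtain a b where "m = a + b" "a \<in> keys p" "b \<in> keys q" using keys_mult[of p q] by blast
  then show "int (monomial_degree m) = d + e"
    using assms by (auto simp: homogeneous_of_degree_def monomial_degree_add)
qed

lemma hom_comp_mult:
  fixes c s :: "('v::finite, 'k::field) mpoly"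
  assumes "homogeneous_of_degree e s"
  shows "hom_comp d (c * s) = hom_comp (d - e) c * s"
proof (induction c rule: poly_mapping_induct)
  case (single m a)
  have m: "homogeneous_of_degree (int (monomial_degree m)) (single m a)"
    by (simp add: homogeneous_of_degree_def)
  show ?case
    unfolding hom_comp_homogeneous[OF homogeneous_mult[OF m assms]] hom_comp_homogeneous[OF m]
    by auto
qed (simp add: hom_comp_add distrib_right)

definition graded :: "('v, 'k::field) mpoly set \<Rightarrow> bool" where
  "graded L \<longleftrightarrow> (\<forall>p\<in>L. \<forall>d. hom_comp d p \<in> L)"

lemma graded_homogeneous_ideal:
  fixes L :: "('v::finite, 'k::field) mpoly set"
  assumes "homogeneous_ideal L"
  shows "graded L"
proof -
  obtain S where S: "\<And>p. p \<in> S \<Longrightarrow> homogeneous p" and L: "L = ideal_generated S"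
    using assms unfolding homogeneous_ideal_def by blast
  have "hom_comp d p \<in> L" if "p \<in> L" for p d
    using that unfolding L
  proof (induction rule: ideal_generated_induct)
    case zero
    then show ?case by (simp add: ideal_zero)
  next
    case (add c s q)
    obtain e where "homogeneous_of_degree e s" using S[OF add(1)] by (auto simp: homogeneous_def)
    then show ?case
      using add by (simp add: hom_comp_add hom_comp_mult ideal_add ideal_mult ideal_generated_base)
  qed
  then show ?thesis by (simp add: graded_def)
qed

lemma graded_Int: "graded L \<Longrightarrow> graded L' \<Longrightarrow> graded (L \<inter> L')"
  by (auto simp: graded_def)

lemma graded_UNIV [simp]: "graded UNIV"
  by (simp add: graded_def)

definition vec_comp :: "('v, 'k::field) free_complex \<Rightarrow> nat \<Rightarrow> int \<Rightarrow> ('v, 'k) vec \<Rightarrow> ('v, 'k) vec" where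
  "vec_comp F i j = Poly_Mapping.mapp (\<lambda>a. hom_comp (j - shift F i a))"

lemma lookup_vec_comp: "lookup (vec_comp F i j w) a = hom_comp (j - shift F i a) (lookup w a)"
  by (auto simp: vec_comp_def lookup_mapp in_keys_iff when_def)

lemma vec_comp_add: "vec_comp F i j (w + w') = vec_comp F i j w + vec_comp F i j w'"
  by (rule poly_mapping_eqI) (simp add: lookup_vec_comp lookup_add hom_comp_add)

lemma vec_comp_zero [simp]: "vec_comp F i j 0 = 0"
  by (rule poly_mapping_eqI) (simp add: lookup_vec_comp)

lemma vec_comp_sum: "vec_comp F i j (sum f A) = (\<Sum>a\<in>A. vec_comp F i j (f a))"
  by (induction A rule: infinite_finite_induct) (simp_all add: vec_comp_add)

lemma vec_comp_vec_comp: "vec_comp F i j (vec_comp F i j' w) = (if j = j' then vec_comp F i j w else 0)"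
  by (rule poly_mapping_eqI) (auto simp: lookup_vec_comp hom_comp_hom_comp)

lemma tensor_piece_iff: "w \<in> tensor_piece F L i j \<longleftrightarrow> w \<in> tensor F L i \<and> vec_comp F i j w = w"
proof -
  have "vec_comp F i j w = w \<longleftrightarrow>
      (\<forall>a<rank F i. homogeneous_of_degree (j - shift F i a) (lookup w a))" if "w \<in> tensor F L i"
  proof -
    have "lookup w a = 0" if "\<not> a < rank F i" for a
      using that \<open>w \<in> tensor F L i\<close> by (simp add: tensor_iff)
    then show ?thesis
      by (auto simp: poly_mapping_eq_iff[of _ w] fun_eq_iff lookup_vec_comp
          homogeneous_iff_hom_comp) (metis hom_comp_zero)
  qed
  then show ?thesis by (auto simp: tensor_piece_def)
qed

lemma vec_comp_in_piece:
  assumes "graded L" "w \<in> tensor F L i"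
  shows "vec_comp F i j w \<in> tensor_piece F L i j"
  using assms by (auto simp: tensor_piece_iff vec_comp_vec_comp tensor_iff lookup_vec_comp graded_def)

lemma vec_comp_piece: "w \<in> tensor_piece F L i j \<Longrightarrow> vec_comp F i j' w = (if j' = j then w else 0)"
  by (metis tensor_piece_iff vec_comp_vec_comp)

text \<open>\<open>j\<close> is put into \<open>D\<close> so that the summand of degree
  \<open>j\<close> can be singled out even when it is zero.\<close>

lemma vec_comp_decompose:
  fixes w :: "('v::finite, 'k::field) vec"
  obtains D where "finite D" "j \<in> D" "w = (\<Sum>j'\<in>D. vec_comp F i j' w)"
proof
  let ?D = "insert j (\<Union>a\<in>keys w. (\<lambda>m. shift F i a + int (monomial_degree m)) ` keys (lookup w a))"
  show "finite ?D" "j \<in> ?D" by auto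
  show "w = (\<Sum>j'\<in>?D. vec_comp F i j' w)"
  proof (rule poly_mapping_eqI, rule poly_mapping_eqI)
    fix a and m :: "'v monomial"
    let ?j = "shift F i a + int (monomial_degree m)"
    have "lookup (lookup (\<Sum>j'\<in>?D. vec_comp F i j' w) a) m =
        (\<Sum>j'\<in>?D. if j' = ?j then lookup (lookup w a) m else 0)"
      unfolding lookup_sum by (intro sum.cong) (auto simp: lookup_vec_comp lookup_hom_comp)
    also have "\<dots> = (if ?j \<in> ?D then lookup (lookup w a) m else 0)"
      using \<open>finite ?D\<close> by (simp only: sum.delta)
    also have "\<dots> = lookup (lookup w a) m"
    proof (cases "lookup (lookup w a) m = 0")
      case False
      then have "a \<in> keys w" "m \<in> keys (lookup w a)" by (auto simp: in_keys_iff)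
      then have "?j \<in> ?D" by blast
      then show ?thesis by simp
    qed simp
    finally show "lookup (lookup w a) m = lookup (lookup (\<Sum>j'\<in>?D. vec_comp F i j' w) a) m" ..
  qed
qed

section \<open>Betti numbers of a sum of ideals\<close>

abbreviation field_scale :: "'k::field \<Rightarrow> ('v, 'k) vec \<Rightarrow> ('v, 'k) vec" where
  "field_scale \<equiv> \<lambda>c. vec_scale (Const c)"

lemma Const_add: "Const (a + b) = Const a + Const b"
  by (simp add: Const_def single_add)

lemma Const_mult: "Const (a * b) = Const a * Const b"
  by (simp add: Const_def mult_single)

lemma Const_1 [simp]: "Const 1 = 1"
  by (simp add: Const_def)

lemma homogeneous_Const: "homogeneous_of_degree 0 (Const c)"
  by (simp add: Const_def homogeneous_of_degree_def)

lemma vector_space_field_scale: "vector_space (field_scale :: 'k::field \<Rightarrow> ('v, 'k) vec \<Rightarrow> _)"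
  by unfold_locales (simp_all add: vec.scale_right_distrib vec.scale_left_distrib Const_add Const_mult)

interpretation P: quotient_space "field_scale :: 'k::field \<Rightarrow> ('v::finite, 'k) vec \<Rightarrow> ('v, 'k) vec"
  unfolding quotient_space_def by (rule vector_space_field_scale)

lemma vec_comp_field_scale:
  fixes w :: "('v::finite, 'k::field) vec"
  shows "vec_comp F i j (field_scale c w) = field_scale c (vec_comp F i j w)"
proof (rule poly_mapping_eqI)
  fix a
  show "lookup (vec_comp F i j (field_scale c w)) a = lookup (field_scale c (vec_comp F i j w)) a"
    using hom_comp_mult[OF homogeneous_Const[of c], of "j - shift F i a" "lookup w a"]
    by (simp add: lookup_vec_comp mult.commute)
qed

lemma subspace_tensor_piece:
  fixes F :: "('v::finite, 'k::field) free_complex"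
  assumes "ideal L"
  shows "P.V.subspace (tensor_piece F L i j)"
  unfolding P.V.subspace_def
  using assms by (auto simp: tensor_piece_iff vec_comp_add vec_comp_field_scale
      tensor_add tensor_zero tensor_scale)

lemma tensor_piece_finite_span:
  fixes F :: "('v::finite, 'k::field) free_complex"
  obtains T where "finite T" "\<And>L. tensor_piece F L i j \<subseteq> P.V.span T"
proof
  let ?M = "\<lambda>a. {m :: 'v monomial. int (monomial_degree m) = j - shift F i a}"
  let ?T = "(\<Union>a<rank F i. (\<lambda>m. single a (single m (1::'k))) ` ?M a)"
  show "finite ?T" by (intro finite_UN_I finite_imageI finite_monomials_of_degree) simp
  fix L show "tensor_piece F L i j \<subseteq> P.V.span ?T"
  proof
    fix w assume w: "w \<in> tensor_piece F L i j"
    have piece: "single a (lookup w a) \<in> P.V.span ?T" if a: "a \<in> keys w" for a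
    proof -
      have ar: "a < rank F i" using a w by (auto simp: tensor_piece_def tensor_def)
      have "single a (lookup w a) =
          (\<Sum>m\<in>keys (lookup w a). field_scale (lookup (lookup w a) m) (single a (single m 1)))"
      proof (rule poly_mapping_eqI)
        fix b
        have "(\<Sum>m\<in>keys (lookup w a). Const (lookup (lookup w a) m) * single m 1) = lookup w a"
          by (simp add: Const_def mult_single poly_mapping_sum_monomials)
        then show "lookup (single a (lookup w a)) b = lookup
          (\<Sum>m\<in>keys (lookup w a). field_scale (lookup (lookup w a) m) (single a (single m 1))) b"
          by (cases "a = b") (simp_all add: lookup_sum lookup_single)
      qed
      also have "\<dots> \<in> P.V.span ?T"
      proof (intro P.V.span_sum P.V.span_scale P.V.span_base)
        fix m assume "m \<in> keys (lookup w a)"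
        then have "m \<in> ?M a" using w ar by (auto simp: tensor_piece_def homogeneous_of_degree_def)
        then show "single a (single m 1) \<in> ?T" using ar by blast
      qed
      finally show ?thesis .
    qed
    have "(\<Sum>a\<in>keys w. single a (lookup w a)) \<in> P.V.span ?T"
      by (rule P.V.span_sum) (rule piece)
    then show "w \<in> P.V.span ?T" by (simp add: poly_mapping_sum_monomials)
  qed
qed

section \<open>Graded pieces of Tor and the splitting formula\<close>

context residue_resolution
begin

lemma diff_vec_comp:
  assumes z: "z \<in> tensor F UNIV (Suc i)"
  shows "diff F i (vec_comp F (Suc i) j z) = vec_comp F i j (diff F i z)"
proof -
  obtain D where D: "finite D" "j \<in> D" "z = (\<Sum>j'\<in>D. vec_comp F (Suc i) j' z)"
    by (rule vec_comp_decompose)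
  have piece: "diff F i (vec_comp F (Suc i) j' z) \<in> tensor_piece F UNIV i j'" for j'
    using diff_piece vec_comp_in_piece[OF graded_UNIV z] by blast
  have "vec_comp F i j (diff F i z) = vec_comp F i j (diff F i (\<Sum>j'\<in>D. vec_comp F (Suc i) j' z))"
    using D(3) by simp
  also have "\<dots> = (\<Sum>j'\<in>D. vec_comp F i j (diff F i (vec_comp F (Suc i) j' z)))"
    by (simp add: diff_sum vec_comp_sum)
  also have "\<dots> = (\<Sum>j'\<in>D. if j' = j then diff F i (vec_comp F (Suc i) j' z) else 0)"
    using vec_comp_piece[OF piece] by (intro sum.cong) auto
  also have "\<dots> = diff F i (vec_comp F (Suc i) j z)" using D(1,2) by simp
  finally show ?thesis ..
qed

definition cycles :: "('v, 'k) mpoly set \<Rightarrow> nat \<Rightarrow> int \<Rightarrow> ('v, 'k) vec set" where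
  "cycles L i j = {w \<in> tensor_piece F L i j. chain_cycle F i w}"

definition boundaries :: "('v, 'k) mpoly set \<Rightarrow> nat \<Rightarrow> int \<Rightarrow> ('v, 'k) vec set" where
  "boundaries L i j = diff F i ` tensor_piece F L (Suc i) j"

definition tor_dim :: "('v, 'k) mpoly set \<Rightarrow> nat \<Rightarrow> int \<Rightarrow> nat" where
  "tor_dim L i j = quotient_dim field_scale (cycles L i j) (boundaries L i j)"

text \<open>The differential commutes with the projection to degree \<open>j\<close>, so any
  preimage in \<open>F \<otimes> L\<close> can be replaced by its component of degree
  \<open>j\<close>. This allows the vanishing statement, proved without grading, to be used degree
  by degree.\<close>

lemma boundaries_iff:
  assumes "ideal L" "graded L"
  shows "w \<in> boundaries L i j \<longleftrightarrow>
    w \<in> tensor_piece F L i j \<and> w \<in> diff F i ` tensor F L (Suc i)"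
proof
  assume "w \<in> boundaries L i j"
  then obtain z where z: "z \<in> tensor F L (Suc i)" "vec_comp F (Suc i) j z = z" "w = diff F i z"
    by (auto simp: boundaries_def tensor_piece_iff)
  then have "z \<in> tensor F UNIV (Suc i)" using tensor_mono[of L UNIV] by blast
  then have "vec_comp F i j w = w" using diff_vec_comp[of z i j] z by simp
  then show "w \<in> tensor_piece F L i j \<and> w \<in> diff F i ` tensor F L (Suc i)"
    using z diff_tensor[OF assms(1) z(1)] by (auto simp: tensor_piece_iff)
next
  assume w: "w \<in> tensor_piece F L i j \<and> w \<in> diff F i ` tensor F L (Suc i)"
  then obtain z where z: "z \<in> tensor F L (Suc i)" "w = diff F i z" by blast
  then have "z \<in> tensor F UNIV (Suc i)" using tensor_mono[of L UNIV] by blast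
  then have "diff F i (vec_comp F (Suc i) j z) = w"
    using diff_vec_comp[of z i j] w z by (simp add: tensor_piece_iff)
  then show "w \<in> boundaries L i j"
    unfolding boundaries_def using vec_comp_in_piece[OF assms(2) z(1)] by blast
qed

lemma linear_diff: "Vector_Spaces.linear field_scale field_scale (diff F i)"
  by (rule Vector_Spaces.linear.intro[OF vector_space_field_scale vector_space_field_scale])
    (simp add: module_hom_iff diff_add diff_scale P.V.module_axioms)

lemma subspace_cycles: "ideal L \<Longrightarrow> P.V.subspace (cycles L i j)"
  using subspace_tensor_piece[of L F i j] unfolding P.V.subspace_def cycles_def
  by (cases i) (auto simp: diff_zero diff_add diff_scale)

lemma subspace_boundaries: "ideal L \<Longrightarrow> P.V.subspace (boundaries L i j)"
  unfolding boundaries_def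
  by (rule module_hom.subspace_image[OF _ subspace_tensor_piece])
    (simp_all add: module_hom_iff diff_add diff_scale P.V.module_axioms)

lemma boundaries_subset_cycles:
  assumes "ideal L" "graded L"
  shows "boundaries L i j \<subseteq> cycles L i j"
proof
  fix w assume w: "w \<in> boundaries L i j"
  then have "w \<in> tensor_piece F L i j" "w \<in> diff F i ` tensor F L (Suc i)"
    using boundaries_iff[OF assms] by blast+
  moreover have "tensor F L (Suc i) \<subseteq> tensor F UNIV (Suc i)" by (rule tensor_mono) simp
  ultimately show "w \<in> cycles L i j"
    unfolding cycles_def using chain_cycle_diff by blast
qed

lemma dim_cycles:
  assumes "ideal L" "graded L"
  shows "P.V.dim (cycles L i j) = P.V.dim (boundaries L i j) + tor_dim L i j"
proof -
  obtain T where "finite T" "tensor_piece F L i j \<subseteq> P.V.span T"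
    using tensor_piece_finite_span by metis
  then show ?thesis
    unfolding tor_dim_def
    by (intro P.quotient_dim_eq subspace_cycles subspace_boundaries boundaries_subset_cycles assms)
      (auto simp: cycles_def)
qed

lemma dim_tensor_piece:
  assumes "ideal L"
  shows "P.V.dim (tensor_piece F L (Suc i) j) =
    P.V.dim (cycles L (Suc i) j) + P.V.dim (boundaries L i j)"
proof -
  obtain T where "finite T" "tensor_piece F L (Suc i) j \<subseteq> P.V.span T"
    using tensor_piece_finite_span by metis
  then show ?thesis
    unfolding cycles_def boundaries_def chain_cycle_simps
    by (intro P.dim_kernel_image linear_diff subspace_tensor_piece assms)
qed

text \<open>The chains for \<open>I\<close> are the sums, and those for \<open>J \<inter> K\<close>
  the intersections, of the chains for \<open>J\<close> and \<open>K\<close>. Boundaries also add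
  up, but \<open>null\<close> makes the boundaries of \<open>J\<close> and \<open>K\<close> meet in
  all cycles of \<open>J \<inter> K\<close>, not just in its boundaries. This excess, one
  homological degree lower, is the third summand.\<close>

lemma tor_dim_splitting:
  assumes J: "ideal J" "graded J" and K: "ideal K" "graded K"
    and I: "ideal I" "graded I" "I = {a + b | a b. a \<in> J \<and> b \<in> K}"
    and null: "\<And>i w. w \<in> tensor F (J \<inter> K) i \<Longrightarrow> chain_cycle F i w \<Longrightarrow>
      w \<in> diff F i ` tensor F J (Suc i) \<and> w \<in> diff F i ` tensor F K (Suc i)"
  shows "tor_dim I i j = tor_dim J i j + tor_dim K i j + (if i = 0 then 0 else tor_dim (J \<inter> K) (i - 1) j)"
proof -
  let ?M = "J \<inter> K"
  have M: "ideal ?M" "graded ?M" using J K by (simp_all add: ideal_Int graded_Int)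
  have piece_Int: "tensor_piece F J i j \<inter> tensor_piece F K i j = tensor_piece F ?M i j" for i
    by (auto simp: tensor_piece_iff tensor_iff)
  have JI: "J \<subseteq> I" using ideal_zero[OF K(1)] I(3) by force
  have KI: "K \<subseteq> I" using ideal_zero[OF J(1)] I(3) by force
  have piece_sum: "tensor_piece F I i j =
      {a + b | a b. a \<in> tensor_piece F J i j \<and> b \<in> tensor_piece F K i j}" for i
  proof (intro equalityI subsetI)
    fix w assume w: "w \<in> tensor_piece F I i j"
    \<comment> \<open>Choosing zero where \<open>w\<close> vanishes keeps the support of the chosen
      part finite.\<close>
    have "\<forall>a. \<exists>p. p \<in> J \<and> lookup w a - p \<in> K \<and> (lookup w a = 0 \<longrightarrow> p = 0)"
    proof
      fix a
      have "lookup w a \<in> I" using w by (simp add: tensor_piece_iff tensor_iff)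
      then obtain p q where "lookup w a = p + q" "p \<in> J" "q \<in> K" unfolding I(3) by blast
      then show "\<exists>p. p \<in> J \<and> lookup w a - p \<in> K \<and> (lookup w a = 0 \<longrightarrow> p = 0)"
        using ideal_zero[OF J(1)] ideal_zero[OF K(1)]
        by (intro exI[of _ "if lookup w a = 0 then 0 else p"]) auto
    qed
    then obtain p where p: "\<And>a. p a \<in> J" "\<And>a. lookup w a - p a \<in> K"
      "\<And>a. lookup w a = 0 \<Longrightarrow> p a = 0" by metis
    have "finite {a. p a \<noteq> 0}"
      by (rule finite_subset[OF _ finite_keys[of w]]) (use p(3) in \<open>auto simp: in_keys_iff\<close>)
    then have lookup_p: "lookup (Abs_poly_mapping p) = p" by simp
    let ?p = "Abs_poly_mapping p"
    have "?p \<in> tensor F J i" "w - ?p \<in> tensor F K i"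
      using p w by (auto simp: tensor_piece_iff tensor_iff lookup_p lookup_minus)
    then have "vec_comp F i j ?p \<in> tensor_piece F J i j" "vec_comp F i j (w - ?p) \<in> tensor_piece F K i j"
      using J K by (auto intro: vec_comp_in_piece)
    moreover have "w = vec_comp F i j ?p + vec_comp F i j (w - ?p)"
      using w by (simp add: tensor_piece_iff flip: vec_comp_add)
    ultimately show "w \<in> {a + b | a b. a \<in> tensor_piece F J i j \<and> b \<in> tensor_piece F K i j}"
      by blast
  next
    fix w assume "w \<in> {a + b | a b. a \<in> tensor_piece F J i j \<and> b \<in> tensor_piece F K i j}"
    then obtain a b where ab: "w = a + b" "a \<in> tensor_piece F J i j" "b \<in> tensor_piece F K i j"
      by blast
    then have "a \<in> tensor F I i" "b \<in> tensor F I i"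
      using subsetD[OF tensor_mono[OF JI]] subsetD[OF tensor_mono[OF KI]]
      by (simp_all add: tensor_piece_iff)
    then show "w \<in> tensor_piece F I i j"
      using ab tensor_add[OF I(1)] by (simp add: tensor_piece_iff vec_comp_add)
  qed
  have p: "P.V.dim (tensor_piece F I i j) + P.V.dim (tensor_piece F ?M i j) =
      P.V.dim (tensor_piece F J i j) + P.V.dim (tensor_piece F K i j)" for i
  proof -
    obtain T where "finite T" "tensor_piece F I i j \<subseteq> P.V.span T"
      using tensor_piece_finite_span by metis
    then show ?thesis
      using P.dim_sum_Int[OF subspace_tensor_piece[OF J(1), of F i j]
          subspace_tensor_piece[OF K(1), of F i j], of T]
      unfolding piece_sum[symmetric] piece_Int by simp
  qed
  have bound_sum: "boundaries I i j = {a + b | a b. a \<in> boundaries J i j \<and> b \<in> boundaries K i j}" for i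
  proof (intro equalityI subsetI)
    fix w assume "w \<in> boundaries I i j"
    then obtain a b where "w = diff F i (a + b)" "a \<in> tensor_piece F J (Suc i) j"
        "b \<in> tensor_piece F K (Suc i) j"
      unfolding boundaries_def piece_sum by blast
    then show "w \<in> {a + b | a b. a \<in> boundaries J i j \<and> b \<in> boundaries K i j}"
      unfolding boundaries_def diff_add by blast
  next
    fix w assume "w \<in> {a + b | a b. a \<in> boundaries J i j \<and> b \<in> boundaries K i j}"
    then obtain a b where "w = diff F i a + diff F i b" "a \<in> tensor_piece F J (Suc i) j"
        "b \<in> tensor_piece F K (Suc i) j"
      unfolding boundaries_def by blast
    then show "w \<in> boundaries I i j"
      unfolding boundaries_def piece_sum diff_add[symmetric] by blast
  qed
  have bound_Int: "boundaries J i j \<inter> boundaries K i j = cycles ?M i j" for i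
  proof (intro equalityI subsetI)
    fix w assume w: "w \<in> boundaries J i j \<inter> boundaries K i j"
    then have "w \<in> tensor_piece F ?M i j"
      using boundaries_iff[OF J] boundaries_iff[OF K] piece_Int by blast
    moreover have "chain_cycle F i w"
      using w boundaries_subset_cycles[OF J] by (auto simp: cycles_def)
    ultimately show "w \<in> cycles ?M i j" by (simp add: cycles_def)
  next
    fix w assume w: "w \<in> cycles ?M i j"
    then have "w \<in> tensor F ?M i" "chain_cycle F i w" by (simp_all add: cycles_def tensor_piece_iff)
    then show "w \<in> boundaries J i j \<inter> boundaries K i j"
      using null w piece_Int unfolding Int_iff boundaries_iff[OF J] boundaries_iff[OF K] cycles_def
      by blast
  qed
  have b: "P.V.dim (boundaries I i j) + P.V.dim (cycles ?M i j) =
      P.V.dim (boundaries J i j) + P.V.dim (boundaries K i j)" for i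
  proof -
    obtain T where "finite T" "tensor_piece F I i j \<subseteq> P.V.span T"
      using tensor_piece_finite_span by metis
    moreover have "boundaries I i j \<subseteq> tensor_piece F I i j" using boundaries_iff[OF I(1,2)] by blast
    ultimately show ?thesis
      using P.dim_sum_Int[OF subspace_boundaries[OF J(1), of i j]
          subspace_boundaries[OF K(1), of i j], of T]
      unfolding bound_sum[symmetric] bound_Int by (meson order_trans)
  qed
  note z = dim_cycles[OF I(1,2)] dim_cycles[OF J] dim_cycles[OF K] dim_cycles[OF M]
  show ?thesis
  proof (cases i)
    case 0
    have "cycles L 0 j = tensor_piece F L 0 j" for L by (simp add: cycles_def)
    then show ?thesis using p[of 0] b[of 0] z[of 0 j] 0 by simp
  next
    case (Suc l)
    then show ?thesis
      using p[of i] b[of l] b[of i] z[of i j] z(4)[of l j] dim_tensor_piece[OF I(1), of l j]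
        dim_tensor_piece[OF J(1), of l j] dim_tensor_piece[OF K(1), of l j]
        dim_tensor_piece[OF M(1), of l j]
      by simp
  qed
qed

end

section \<open>Existence of a resolution of the residue field\<close>

text \<open>The ideal generated by the variables in \<open>Z\<close>, described by exponents so that
  membership is decided one monomial at a time.\<close>

definition var_ideal :: "'v var set \<Rightarrow> ('v, 'k::field) mpoly set" where
  "var_ideal Z = {p. \<forall>m\<in>keys p. \<exists>z\<in>Z. lookup m z \<noteq> 0}"

lemma ideal_var_ideal: "ideal (var_ideal Z :: ('v, 'k::field) mpoly set)"
  unfolding ideal_iff
proof (intro conjI ballI allI)
  show "(0 :: ('v, 'k) mpoly) \<in> var_ideal Z" by (simp add: var_ideal_def)
next
  fix a b :: "('v, 'k) mpoly" assume "a \<in> var_ideal Z" "b \<in> var_ideal Z"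
  then show "a + b \<in> var_ideal Z" using keys_add[of a b] unfolding var_ideal_def by blast
next
  fix c a :: "('v, 'k) mpoly" assume a: "a \<in> var_ideal Z"
  have "\<exists>z\<in>Z. lookup m z \<noteq> 0" if m: "m \<in> keys (c * a)" for m
  proof -
    obtain m1 m2 where "m = m1 + m2" "m2 \<in> keys a" using keys_mult[of c a] m by blast
    then show ?thesis using a by (auto simp: var_ideal_def lookup_add)
  qed
  then show "c * a \<in> var_ideal Z" by (simp add: var_ideal_def)
qed

lemma var_ideal_empty: "var_ideal {} = {0}"
  by (auto simp: var_ideal_def)

lemma var_ideal_UNIV: "p \<in> var_ideal UNIV \<longleftrightarrow> lookup p 0 = 0"
proof
  assume "p \<in> var_ideal UNIV"
  then have "0 \<notin> keys p" by (auto simp: var_ideal_def)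
  then show "lookup p 0 = 0" by (simp add: in_keys_iff)
next
  assume p: "lookup p 0 = 0"
  have "\<exists>z. lookup m z \<noteq> 0" if "m \<in> keys p" for m
  proof (rule ccontr)
    assume "\<not> ?thesis"
    then have "m = 0" by (intro poly_mapping_eqI) simp
    then show False using p that by (simp add: in_keys_iff)
  qed
  then show "p \<in> var_ideal UNIV" by (simp add: var_ideal_def)
qed

lemma lookup_Var_mult: "lookup (Var z * c) (single z 1 + m) = lookup c m"
  by (induction c rule: poly_mapping_induct)
    (simp_all add: Var_mult_single lookup_single when_def distrib_left lookup_add)

text \<open>The variables form a regular sequence: a monomial multiplied by \<open>z\<close> is
  divisible by a variable of \<open>Z\<close> only if it was so before, as
  \<open>z \<notin> Z\<close>.\<close>

lemma var_ideal_cancel: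
  assumes "z \<notin> Z" "Var z * c \<in> var_ideal Z"
  shows "c \<in> var_ideal Z"
  unfolding var_ideal_def
proof (intro CollectI ballI)
  fix m assume "m \<in> keys c"
  then have "single z 1 + m \<in> keys (Var z * c)"
    using lookup_Var_mult[of z c m] by (simp add: in_keys_iff)
  then obtain z' where "z' \<in> Z" "lookup (single z 1 + m) z' \<noteq> 0"
    using assms(2) unfolding var_ideal_def by blast
  then show "\<exists>z\<in>Z. lookup m z \<noteq> 0"
    using assms(1) by (intro bexI[of _ z']) (auto simp: lookup_add lookup_single when_def split: if_splits)
qed

lemma var_ideal_insert: "p \<in> var_ideal (insert z Z) \<longleftrightarrow> (\<exists>q. p - Var z * q \<in> var_ideal Z)"
proof
  assume p: "p \<in> var_ideal (insert z Z)"
  have "\<exists>q. p - mono_map (\<lambda>m. lookup m z = 0) (\<lambda>m. m) p = Var z * q"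
  proof (induction p rule: poly_mapping_induct)
    case (single m c)
    show ?case
    proof (cases "lookup m z = 0")
      case True
      then show ?thesis by (intro exI[of _ 0]) (simp add: mono_map_single)
    next
      case False
      then have "single m c = Var z * single (m - single z 1) c"
        using mono_split[of m z] by (simp add: Var_mult_single add.commute)
      moreover have "mono_map (\<lambda>m. lookup m z = 0) (\<lambda>m. m) (single m c) = 0"
        using False by (simp add: mono_map_single)
      ultimately show ?thesis by (metis diff_zero)
    qed
  next
    case (add p q)
    then obtain p' q' where "p - mono_map (\<lambda>m. lookup m z = 0) (\<lambda>m. m) p = Var z * p'"
      "q - mono_map (\<lambda>m. lookup m z = 0) (\<lambda>m. m) q = Var z * q'" by blast
    moreover have "p + q - mono_map (\<lambda>m. lookup m z = 0) (\<lambda>m. m) (p + q) =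
        (p - mono_map (\<lambda>m. lookup m z = 0) (\<lambda>m. m) p) +
        (q - mono_map (\<lambda>m. lookup m z = 0) (\<lambda>m. m) q)"
      by (simp add: mono_map_add)
    ultimately show ?case by (metis distrib_left)
  qed
  then obtain q where "p - mono_map (\<lambda>m. lookup m z = 0) (\<lambda>m. m) p = Var z * q" ..
  then have "p - Var z * q = mono_map (\<lambda>m. lookup m z = 0) (\<lambda>m. m) p"
    by (simp add: algebra_simps)
  moreover have "mono_map (\<lambda>m. lookup m z = 0) (\<lambda>m. m) p \<in> var_ideal Z"
    unfolding var_ideal_def
  proof (intro CollectI ballI)
    fix m assume "m \<in> keys (mono_map (\<lambda>m. lookup m z = 0) (\<lambda>m. m) p)"
    then have "lookup m z = 0" "m \<in> keys p"
      by (auto simp: in_keys_iff lookup_mono_map_id split: if_splits)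
    then show "\<exists>z\<in>Z. lookup m z \<noteq> 0" using p unfolding var_ideal_def by auto
  qed
  ultimately show "\<exists>q. p - Var z * q \<in> var_ideal Z" by metis
next
  assume "\<exists>q. p - Var z * q \<in> var_ideal Z"
  then obtain q where "p - Var z * q \<in> var_ideal Z" ..
  then have "p - Var z * q \<in> var_ideal (insert z Z)" by (auto simp: var_ideal_def)
  moreover have "Var z \<in> var_ideal (insert z Z)"
    by (simp add: Var_def var_ideal_def)
  then have "Var z * q \<in> var_ideal (insert z Z)" by (rule ideal_mult_right[OF ideal_var_ideal])
  ultimately show "p \<in> var_ideal (insert z Z)"
    using ideal_add[OF ideal_var_ideal, of "p - Var z * q" "insert z Z" "Var z * q"] by simp
qed

section \<open>Mapping cones and the Koszul complex\<close>

definition vec_take :: "nat \<Rightarrow> ('v, 'k::field) vec \<Rightarrow> ('v, 'k) vec" where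
  "vec_take r = mono_map (\<lambda>a. a < r) (\<lambda>a. a)"

definition vec_drop :: "nat \<Rightarrow> ('v, 'k::field) vec \<Rightarrow> ('v, 'k) vec" where
  "vec_drop r = mono_map (\<lambda>a. r \<le> a) (\<lambda>a. a - r)"

definition vec_shift :: "nat \<Rightarrow> ('v, 'k::field) vec \<Rightarrow> ('v, 'k) vec" where
  "vec_shift r = mono_map (\<lambda>_. True) (\<lambda>a. a + r)"

lemma lookup_vec_take: "lookup (vec_take r w) a = (if a < r then lookup w a else 0)"
  by (simp add: vec_take_def lookup_mono_map_id)

lemma lookup_vec_drop: "lookup (vec_drop r w) a = lookup w (a + r)"
  unfolding vec_drop_def
  by (induction w rule: poly_mapping_induct)
    (auto simp: mono_map_single mono_map_add lookup_add lookup_single when_def)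

lemma lookup_vec_shift: "lookup (vec_shift r w) a = (if a < r then 0 else lookup w (a - r))"
  unfolding vec_shift_def
  by (induction w rule: poly_mapping_induct)
    (auto simp: mono_map_single mono_map_add lookup_add lookup_single when_def)

lemma vec_hom_take: "vec_hom (vec_take r)"
  by (rule vec_homI) (auto intro!: poly_mapping_eqI simp: lookup_vec_take lookup_add)

lemma vec_hom_drop: "vec_hom (vec_drop r)"
  by (rule vec_homI) (auto intro!: poly_mapping_eqI simp: lookup_vec_drop lookup_add)

lemma vec_hom_shift: "vec_hom (vec_shift r)"
  by (rule vec_homI) (auto intro!: poly_mapping_eqI simp: lookup_vec_shift lookup_add)

lemma vec_take_drop: "vec_take r w + vec_shift r (vec_drop r w) = w"
  by (rule poly_mapping_eqI) (auto simp: lookup_vec_take lookup_vec_drop lookup_vec_shift lookup_add)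

lemma vec_take_pair: "\<forall>a\<ge>r. lookup w a = 0 \<Longrightarrow> vec_take r (w + vec_shift r w') = w"
  by (rule poly_mapping_eqI) (auto simp: lookup_vec_take lookup_vec_shift lookup_add)

lemma vec_drop_pair: "\<forall>a\<ge>r. lookup w a = 0 \<Longrightarrow> vec_drop r (w + vec_shift r w') = w'"
  by (rule poly_mapping_eqI) (auto simp: lookup_vec_drop lookup_vec_shift lookup_add)

text \<open>The mapping cone of multiplication by \<open>z\<close> on \<open>F\<close>. Degree
  \<open>i\<close> is the sum of \<open>F_i\<close>, in the first coordinates, and
  \<open>F_(i-1)\<close>, with shifts raised by 1 because \<open>z\<close> has degree 1. The
  differential sends \<open>(w1, w2)\<close> to \<open>(d w1 + z w2, - d w2)\<close>. Iterated over
  all variables, starting from the ring itself, it yields the Koszul complex.\<close>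

definition cone :: "'v var \<Rightarrow> ('v, 'k::field) free_complex \<Rightarrow> ('v, 'k) free_complex" where
  "cone z F = \<lparr>
     rank = (\<lambda>i. case i of 0 \<Rightarrow> rank F 0 | Suc l \<Rightarrow> rank F (Suc l) + rank F l),
     shift = (\<lambda>i a. case i of 0 \<Rightarrow> shift F 0 a | Suc l \<Rightarrow>
       if a < rank F (Suc l) then shift F (Suc l) a else shift F l (a - rank F (Suc l)) + 1),
     diff = (\<lambda>i w. diff F i (vec_take (rank F (Suc i)) w) +
       vec_scale (Var z) (vec_drop (rank F (Suc i)) w) -
       (case i of 0 \<Rightarrow> 0 | Suc l \<Rightarrow>
         vec_shift (rank F (Suc l)) (diff F l (vec_drop (rank F (Suc i)) w)))) \<rparr>"

lemma cone_simps:
  "rank (cone z F) 0 = rank F 0"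
  "rank (cone z F) (Suc l) = rank F (Suc l) + rank F l"
  "shift (cone z F) 0 a = shift F 0 a"
  "shift (cone z F) (Suc l) a =
    (if a < rank F (Suc l) then shift F (Suc l) a else shift F l (a - rank F (Suc l)) + 1)"
  "diff (cone z F) 0 w = diff F 0 (vec_take (rank F (Suc 0)) w) +
    vec_scale (Var z) (vec_drop (rank F (Suc 0)) w)"
  "diff (cone z F) (Suc l) w = diff F (Suc l) (vec_take (rank F (Suc (Suc l))) w) +
    vec_scale (Var z) (vec_drop (rank F (Suc (Suc l))) w) -
    vec_shift (rank F (Suc l)) (diff F l (vec_drop (rank F (Suc (Suc l))) w))"
  by (simp_all add: cone_def)

text \<open>\<open>F\<close> resolves the quotient of the polynomial ring by the variables in \<open>Z\<close>.\<close>

definition resolves :: "('v, 'k::field) free_complex \<Rightarrow> 'v var set \<Rightarrow> bool" where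
  "resolves F Z \<longleftrightarrow>
     (\<forall>i. vec_hom (diff F i)) \<and>
     (\<forall>i j. diff F i ` tensor_piece F UNIV (Suc i) j \<subseteq> tensor_piece F UNIV i j) \<and>
     (\<forall>i. diff F (Suc i) ` tensor F UNIV (Suc (Suc i)) =
            {w \<in> tensor F UNIV (Suc i). diff F i w = 0}) \<and>
     rank F 0 = 1 \<and> shift F 0 0 = 0 \<and>
     diff F 0 ` tensor F UNIV (Suc 0) = {w \<in> tensor F UNIV 0. lookup w 0 \<in> var_ideal Z}"

lemma resolves_empty:
  "resolves \<lparr>rank = (\<lambda>i. if i = 0 then 1 else 0), shift = (\<lambda>_ _. 0), diff = (\<lambda>_ _. 0)\<rparr> {}"
proof -
  let ?F = "\<lparr>rank = (\<lambda>i. if i = 0 then 1 else 0), shift = (\<lambda>_ _. 0), diff = (\<lambda>_ _. 0)\<rparr>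
    :: ('a, 'b) free_complex"
  have "tensor ?F UNIV (Suc i) = {0}" for i by (auto simp: tensor_def)
  moreover have "w = 0" if "w \<in> tensor ?F UNIV 0" "lookup w 0 = 0" for w
  proof (rule poly_mapping_eqI)
    fix a show "lookup w a = lookup 0 a" using that by (cases a) (auto simp: tensor_iff)
  qed
  ultimately show ?thesis
    by (auto simp: resolves_def module_hom_iff module_vec_scale tensor_piece_iff var_ideal_empty
        tensor_zero)
qed

lemma Var_homogeneous: "homogeneous_of_degree 1 (Var z)"
  by (simp add: homogeneous_of_degree_def Var_def monomial_degree_def)

text \<open>For a cycle \<open>(w1, w2)\<close> of the cone, \<open>w2\<close> turns out to be a
  boundary of \<open>F\<close>, after which \<open>w1\<close> can be corrected to a cycle of
  \<open>F\<close>. Regularity of \<open>z\<close> modulo the earlier variables is used just at the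
  bottom, where \<open>w2\<close> lies in \<open>F_0\<close>.\<close>

lemma resolves_cone:
  fixes F :: "('v::finite, 'k::field) free_complex"
  assumes F: "resolves F Z" and z: "z \<notin> Z"
  shows "resolves (cone z F) (insert z Z)"
proof -
  let ?C = "cone z F"
  have F': "\<forall>i. vec_hom (diff F i)"
    "\<forall>i j. diff F i ` tensor_piece F UNIV (Suc i) j \<subseteq> tensor_piece F UNIV i j"
    "\<forall>i. diff F (Suc i) ` tensor F UNIV (Suc (Suc i)) =
       {w \<in> tensor F UNIV (Suc i). diff F i w = 0}"
    and rank0: "rank F 0 = 1" and shift0: "shift F 0 0 = 0"
    and exact0: "diff F 0 ` tensor F UNIV (Suc 0) = {w \<in> tensor F UNIV 0. lookup w 0 \<in> var_ideal Z}"
    using F unfolding resolves_def by - (elim conjE, assumption)+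
  note hom = spec[OF F'(1)] and piece = spec[OF spec[OF F'(2)]] and exact = spec[OF F'(3)]
  note add = vec_hom_add[OF hom] vec_hom_add[OF vec_hom_take] vec_hom_add[OF vec_hom_drop]
    vec_hom_add[OF vec_hom_shift]
  note scale = vec_hom_scale[OF hom] vec_hom_scale[OF vec_hom_take] vec_hom_scale[OF vec_hom_drop]
    vec_hom_scale[OF vec_hom_shift]
  note zero = vec_hom_zero[OF hom] vec_hom_zero[OF vec_hom_shift]
  have neg: "f (- x) = - f x" if "vec_hom f" for f :: "('v, 'k) vec \<Rightarrow> ('v, 'k) vec" and x
    using vec_hom_diff[OF that, of 0 x] vec_hom_zero[OF that] by simp
  have dT: "diff F i w \<in> tensor F UNIV i" if "w \<in> tensor F UNIV (Suc i)" for i w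
    using exact0 exact that by (cases i) blast+
  have dd: "diff F i (diff F (Suc i) w) = 0" if "w \<in> tensor F UNIV (Suc (Suc i))" for i w
    using exact that by blast
  have take_T: "vec_take (rank F i) w \<in> tensor F UNIV i" for i w
    by (simp add: tensor_iff lookup_vec_take)
  have drop_T: "vec_drop (rank F (Suc i)) w \<in> tensor F UNIV i"
    if "w \<in> tensor ?C UNIV (Suc i)" for i w
    using that by (simp add: tensor_iff lookup_vec_drop cone_simps)
  have pair_T: "w1 + vec_shift (rank F (Suc i)) w2 \<in> tensor ?C UNIV (Suc i)"
    if "w1 \<in> tensor F UNIV (Suc i)" "w2 \<in> tensor F UNIV i" for i w1 w2
    using that by (auto simp: tensor_iff lookup_vec_shift lookup_add cone_simps)
  have T0: "tensor ?C UNIV 0 = tensor F UNIV 0" by (simp add: tensor_def cone_simps)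
  have diff_pair: "diff ?C (Suc l) (w1 + vec_shift (rank F (Suc (Suc l))) w2) =
      (diff F (Suc l) w1 + vec_scale (Var z) w2) + vec_shift (rank F (Suc l)) (- diff F l w2)"
    if "w1 \<in> tensor F UNIV (Suc (Suc l))" for l w1 w2
    using that vec_take_pair[of "rank F (Suc (Suc l))" w1 w2]
      vec_drop_pair[of "rank F (Suc (Suc l))" w1 w2]
    by (simp add: cone_simps tensor_iff neg[OF vec_hom_shift])
  have diff_pair0: "diff ?C 0 (w1 + vec_shift (rank F (Suc 0)) w2) =
      diff F 0 w1 + vec_scale (Var z) w2" if "w1 \<in> tensor F UNIV (Suc 0)" for w1 w2
    using that vec_take_pair[of "rank F (Suc 0)" w1 w2] vec_drop_pair[of "rank F (Suc 0)" w1 w2]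
    by (simp add: cone_simps tensor_iff)
  have split: "\<exists>w1 w2. w1 \<in> tensor F UNIV (Suc i) \<and> w2 \<in> tensor F UNIV i \<and>
      w = w1 + vec_shift (rank F (Suc i)) w2" if "w \<in> tensor ?C UNIV (Suc i)" for i w
    using take_T drop_T[OF that] vec_take_drop[symmetric] by blast
  have pair_zero: "w1 = 0 \<and> w2 = 0"
    if "w1 + vec_shift (rank F (Suc i)) w2 = 0" "w1 \<in> tensor F UNIV (Suc i)" for i w1 w2
  proof -
    have "\<forall>a\<ge>rank F (Suc i). lookup w1 a = 0" using that by (simp add: tensor_iff)
    from vec_take_pair[OF this, of w2] vec_drop_pair[OF this, of w2] show ?thesis
      unfolding that(1) using vec_hom_zero[OF vec_hom_take] vec_hom_zero[OF vec_hom_drop] by metis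
  qed
  have "vec_hom (diff ?C i)" for i
    by (cases i; rule vec_homI) (simp_all add: cone_simps add scale vec.scale_right_distrib
      vec.scale_right_diff_distrib mult.commute)
  moreover have "diff ?C i ` tensor_piece ?C UNIV (Suc i) j \<subseteq> tensor_piece ?C UNIV i j" for i j
  proof
    fix y assume "y \<in> diff ?C i ` tensor_piece ?C UNIV (Suc i) j"
    then obtain w where w: "w \<in> tensor_piece ?C UNIV (Suc i) j" "y = diff ?C i w" by blast
    let ?w1 = "vec_take (rank F (Suc i)) w" and ?w2 = "vec_drop (rank F (Suc i)) w"
    have wT: "w \<in> tensor ?C UNIV (Suc i)" using w by (simp add: tensor_piece_def)
    have hw: "homogeneous_of_degree (j - shift ?C (Suc i) a) (lookup w a)"
      if "a < rank ?C (Suc i)" for a using w that by (simp add: tensor_piece_def)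
    have "homogeneous_of_degree (j - shift F (Suc i) a) (lookup ?w1 a)" if "a < rank F (Suc i)" for a
      using hw[of a] that by (simp add: cone_simps lookup_vec_take)
    then have w1: "?w1 \<in> tensor_piece F UNIV (Suc i) j"
      using take_T by (simp add: tensor_piece_def)
    \<comment> \<open>The raised shift places the second component in degree \<open>j - 1\<close>;
      multiplication by \<open>z\<close> brings it back to degree \<open>j\<close>.\<close>
    have hw2: "homogeneous_of_degree (j - 1 - shift F i a) (lookup ?w2 a)" if "a < rank F i" for a
      using hw[of "a + rank F (Suc i)"] that by (simp add: cone_simps lookup_vec_drop algebra_simps)
    then have w2: "?w2 \<in> tensor_piece F UNIV i (j - 1)"
      using drop_T[OF wT] by (simp add: tensor_piece_def)
    have zw2: "vec_scale (Var z) ?w2 \<in> tensor_piece F UNIV i j"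
      using homogeneous_mult[OF Var_homogeneous hw2] drop_T[OF wT]
      by (simp add: tensor_piece_def tensor_scale)
    have A: "diff F i ?w1 + vec_scale (Var z) ?w2 \<in> tensor_piece F UNIV i j"
      by (rule P.V.subspace_add[OF subspace_tensor_piece[OF ideal_UNIV]
            subsetD[OF piece imageI[OF w1]] zw2])
    show "y \<in> tensor_piece ?C UNIV i j"
    proof (cases i)
      case 0
      then show ?thesis using A w(2) T0 by (simp add: cone_simps tensor_piece_def)
    next
      case (Suc l)
      let ?A = "diff F i ?w1 + vec_scale (Var z) ?w2" and ?B = "diff F l ?w2"
      have B: "?B \<in> tensor_piece F UNIV l (j - 1)"
        using subsetD[OF piece imageI, of ?w2 l "j - 1"] w2 Suc by simp
      have y: "y = ?A - vec_shift (rank F (Suc l)) ?B" using w(2) Suc by (simp add: cone_simps)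
      have lookup_y: "lookup y a = (if a < rank F (Suc l) then lookup ?A a
          else - lookup ?B (a - rank F (Suc l)))" for a
        using A Suc unfolding y lookup_minus lookup_vec_shift
        by (auto simp: tensor_piece_def tensor_iff)
      have "y \<in> tensor ?C UNIV i"
        using B Suc by (auto simp: tensor_iff lookup_y cone_simps tensor_piece_def)
      moreover have "homogeneous_of_degree (j - shift ?C i a) (lookup y a)" if "a < rank ?C i" for a
      proof (cases "a < rank F (Suc l)")
        case True
        then show ?thesis using A Suc by (simp add: lookup_y cone_simps tensor_piece_def)
      next
        case False
        then have "homogeneous_of_degree (j - 1 - shift F l (a - rank F (Suc l)))
            (lookup ?B (a - rank F (Suc l)))"
          using B that Suc by (simp add: tensor_piece_def cone_simps)
        then show ?thesis
          using False Suc by (simp add: lookup_y cone_simps homogeneous_of_degree_def algebra_simps)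
      qed
      ultimately show ?thesis by (simp add: tensor_piece_def)
    qed
  qed
  moreover have "diff ?C (Suc i) ` tensor ?C UNIV (Suc (Suc i)) =
      {w \<in> tensor ?C UNIV (Suc i). diff ?C i w = 0}" for i
  proof (intro equalityI subsetI)
    fix y assume "y \<in> diff ?C (Suc i) ` tensor ?C UNIV (Suc (Suc i))"
    then obtain w1 w2 where w: "w1 \<in> tensor F UNIV (Suc (Suc i))" "w2 \<in> tensor F UNIV (Suc i)"
      "y = diff ?C (Suc i) (w1 + vec_shift (rank F (Suc (Suc i))) w2)"
      using split by blast
    have y: "y = (diff F (Suc i) w1 + vec_scale (Var z) w2) +
        vec_shift (rank F (Suc i)) (- diff F i w2)"
      by (simp only: w(3) diff_pair[OF w(1)])
    have A: "diff F (Suc i) w1 + vec_scale (Var z) w2 \<in> tensor F UNIV (Suc i)"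
      using w dT by (intro tensor_add tensor_scale) auto
    have B: "- diff F i w2 \<in> tensor F UNIV i"
      using tensor_diff[OF ideal_UNIV tensor_zero[OF ideal_UNIV] dT[OF w(2)]] by simp
    have "diff ?C i y = 0"
    proof (cases i)
      case 0
      have "diff ?C i y = diff F 0 (diff F (Suc 0) w1 + vec_scale (Var z) w2) +
          vec_scale (Var z) (- diff F 0 w2)"
        unfolding y using diff_pair0 A 0 by simp
      then show ?thesis
        using dd[of w1 0] w(1) 0 by (simp add: add scale vec.scale_minus_right)
    next
      case (Suc l)
      have "diff ?C i y = (diff F (Suc l) (diff F (Suc (Suc l)) w1 + vec_scale (Var z) w2) +
          vec_scale (Var z) (- diff F (Suc l) w2)) +
          vec_shift (rank F (Suc l)) (- diff F l (- diff F (Suc l) w2))"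
        unfolding y using diff_pair A Suc by simp
      then show ?thesis
        using dd[of w1 "Suc l"] dd[of w2 l] w(1,2) Suc
        by (simp add: add scale neg[OF hom] zero vec.scale_minus_right)
    qed
    then show "y \<in> {w \<in> tensor ?C UNIV (Suc i). diff ?C i w = 0}"
      using pair_T[OF A B] y by simp
  next
    fix w assume "w \<in> {w \<in> tensor ?C UNIV (Suc i). diff ?C i w = 0}"
    then obtain w1 w2 where w: "w1 \<in> tensor F UNIV (Suc i)" "w2 \<in> tensor F UNIV i"
      "w = w1 + vec_shift (rank F (Suc i)) w2" "diff ?C i w = 0"
      using split by blast
    have "(diff F i w1 + vec_scale (Var z) w2 = 0) \<and> w2 \<in> diff F i ` tensor F UNIV (Suc i)"
    proof (cases i)
      case 0
      then have eq: "diff F 0 w1 + vec_scale (Var z) w2 = 0"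
        using w diff_pair0 by simp
      then have "vec_scale (Var z) w2 = diff F 0 (- w1)"
        by (simp add: neg[OF hom] eq_neg_iff_add_eq_0 add.commute)
      moreover have "- w1 \<in> tensor F UNIV (Suc 0)" using w(1) 0 by (simp add: tensor_iff)
      ultimately have "lookup (vec_scale (Var z) w2) 0 \<in> var_ideal Z" using exact0 by blast
      then have "lookup w2 0 \<in> var_ideal Z" using var_ideal_cancel[OF z] by simp
      then show ?thesis using eq w(2) exact0 0 by simp
    next
      case (Suc l)
      have A: "diff F (Suc l) w1 + vec_scale (Var z) w2 \<in> tensor F UNIV (Suc l)"
        using w(1,2) dT Suc by (intro tensor_add tensor_scale) auto
      have "(diff F (Suc l) w1 + vec_scale (Var z) w2) +
          vec_shift (rank F (Suc l)) (- diff F l w2) = 0"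
        using w(4) diff_pair[of w1 l w2] w(1) unfolding w(3) Suc by simp
      from pair_zero[OF this A] show ?thesis using exact[of l] w(2) Suc by simp
    qed
    then obtain y2 where y2: "y2 \<in> tensor F UNIV (Suc i)" "w2 = diff F i y2"
      "diff F i w1 + vec_scale (Var z) w2 = 0" by blast
    then have "diff F i (w1 + vec_scale (Var z) y2) = 0" by (simp add: add scale)
    moreover have "w1 + vec_scale (Var z) y2 \<in> tensor F UNIV (Suc i)"
      using w y2 by (intro tensor_add tensor_scale) auto
    ultimately obtain y1 where y1: "y1 \<in> tensor F UNIV (Suc (Suc i))"
      "diff F (Suc i) y1 = w1 + vec_scale (Var z) y2"
      using exact[of i] by (metis (mono_tags, lifting) imageE mem_Collect_eq)
    \<comment> \<open>The minus sign in the second component of the differential makes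
      \<open>(y1, - y2)\<close> the preimage of \<open>(w1, w2)\<close>.\<close>
    have "- y2 \<in> tensor F UNIV (Suc i)" using y2(1) by (simp add: tensor_iff)
    then have "y1 + vec_shift (rank F (Suc (Suc i))) (- y2) \<in> tensor ?C UNIV (Suc (Suc i))"
      by (rule pair_T[OF y1(1)])
    moreover have "diff ?C (Suc i) (y1 + vec_shift (rank F (Suc (Suc i))) (- y2)) = w"
      unfolding diff_pair[OF y1(1)] y1(2) w(3) y2(2)
      by (simp add: neg[OF hom] vec.scale_minus_right)
    ultimately show "w \<in> diff ?C (Suc i) ` tensor ?C UNIV (Suc (Suc i))" by blast
  qed
  moreover have "diff ?C 0 ` tensor ?C UNIV (Suc 0) =
      {w \<in> tensor ?C UNIV 0. lookup w 0 \<in> var_ideal (insert z Z)}"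
  proof (intro equalityI subsetI)
    fix y assume "y \<in> diff ?C 0 ` tensor ?C UNIV (Suc 0)"
    then obtain w1 w2 where w: "w1 \<in> tensor F UNIV (Suc 0)" "w2 \<in> tensor F UNIV 0"
      "y = diff ?C 0 (w1 + vec_shift (rank F (Suc 0)) w2)"
      using split by blast
    then have y: "y = diff F 0 w1 + vec_scale (Var z) w2" using diff_pair0[OF w(1)] by simp
    have "lookup (diff F 0 w1) 0 \<in> var_ideal Z" using exact0 w(1) by blast
    then have "lookup y 0 - Var z * lookup w2 0 \<in> var_ideal Z" by (simp add: y lookup_add)
    then have "lookup y 0 \<in> var_ideal (insert z Z)" unfolding var_ideal_insert by blast
    moreover have "y \<in> tensor F UNIV 0" unfolding y using w dT by (intro tensor_add tensor_scale) auto
    ultimately show "y \<in> {w \<in> tensor ?C UNIV 0. lookup w 0 \<in> var_ideal (insert z Z)}"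
      using T0 by simp
  next
    fix w assume "w \<in> {w \<in> tensor ?C UNIV 0. lookup w 0 \<in> var_ideal (insert z Z)}"
    then obtain q where w: "w \<in> tensor F UNIV 0" and q: "lookup w 0 - Var z * q \<in> var_ideal Z"
      using T0 var_ideal_insert by blast
    let ?w2 = "single 0 q :: ('v, 'k) vec"
    have w2: "?w2 \<in> tensor F UNIV 0" using rank0 by (auto simp: tensor_iff lookup_single when_def)
    then have "w - vec_scale (Var z) ?w2 \<in> tensor F UNIV 0"
      using w by (intro tensor_diff tensor_scale) auto
    moreover have "lookup (w - vec_scale (Var z) ?w2) 0 \<in> var_ideal Z"
      using q by (simp add: lookup_minus)
    ultimately obtain w1 where w1: "w1 \<in> tensor F UNIV (Suc 0)"
      "diff F 0 w1 = w - vec_scale (Var z) ?w2"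
      using exact0 by (metis (mono_tags, lifting) imageE mem_Collect_eq)
    then have "diff ?C 0 (w1 + vec_shift (rank F (Suc 0)) ?w2) = w"
      by (simp add: diff_pair0)
    then show "w \<in> diff ?C 0 ` tensor ?C UNIV (Suc 0)" using pair_T[OF w1(1) w2] by blast
  qed
  ultimately show ?thesis using rank0 shift0 by (simp add: resolves_def cone_simps)
qed

lemma resolves_exists: "\<exists>F :: ('v::finite, 'k::field) free_complex. resolves F UNIV"
proof -
  have "finite Z \<Longrightarrow> \<exists>F :: ('v, 'k) free_complex. resolves F Z" for Z :: "'v var set"
    by (induction Z rule: finite_induct) (blast intro: resolves_empty resolves_cone)+
  then show ?thesis by simp
qed

lemma lookup_mult_0:
  fixes p q :: "('v, 'k::field) mpoly"
  shows "lookup (p * q) 0 = lookup p 0 * lookup q 0"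
proof -
  let ?\<phi> = "mono_map (\<lambda>m. m = 0) (\<lambda>m. m) :: ('v, 'k) mpoly \<Rightarrow> _"
  have single: "?\<phi> r = single 0 (lookup r 0)" for r
    by (rule poly_mapping_eqI) (auto simp: lookup_mono_map_id lookup_single when_def)
  have zero: "m + m' = 0 \<longleftrightarrow> m = 0 \<and> m' = 0" for m m' :: "'v monomial"
    by (auto simp: poly_mapping_eq_iff fun_eq_iff lookup_add)
  have "?\<phi> (p * q) = ?\<phi> p * ?\<phi> q" for p q by (rule mono_map_mult) (simp_all add: zero)
  then have "single (0 :: 'v monomial) (lookup (p * q) 0) = single 0 (lookup p 0 * lookup q 0)"
    by (simp add: single mult_single)
  then show ?thesis by (metis lookup_single_eq)
qed

lemma module_residue_scale: "module (residue_scale :: ('v, 'k::field) mpoly \<Rightarrow> 'k \<Rightarrow> 'k)"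
  by unfold_locales (simp_all add: residue_scale_def lookup_add lookup_mult_0 algebra_simps)

lemma residue_field_resolution:
  "graded_free_resolution_of_residue_field (residue_field_resolution :: ('v::finite, 'k::field) free_complex)"
proof -
  obtain F :: "('v, 'k) free_complex" where F: "resolves F UNIV" using resolves_exists by blast
  define \<epsilon> :: "('v, 'k) vec \<Rightarrow> 'k" where "\<epsilon> w = lookup (lookup w 0) 0" for w
  have "module_hom vec_scale residue_scale \<epsilon>"
    unfolding module_hom_iff
    using module_vec_scale module_residue_scale
    by (simp add: \<epsilon>_def lookup_add residue_scale_def lookup_mult_0)
  moreover have "\<epsilon> ` tensor_piece F UNIV 0 j \<subseteq> {0}" if "j \<noteq> 0" for j
  proof clarify
    fix w assume "w \<in> tensor_piece F UNIV 0 j"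
    then have "homogeneous_of_degree j (lookup w 0)"
      using F by (auto simp: resolves_def tensor_piece_def)
    then have "0 \<notin> keys (lookup w 0)" using that by (auto simp: homogeneous_of_degree_def)
    then show "\<epsilon> w = 0" by (simp add: \<epsilon>_def in_keys_iff)
  qed
  moreover have "\<epsilon> ` tensor F UNIV 0 = UNIV"
  proof -
    have "\<epsilon> (single 0 (Const c)) = c \<and> single 0 (Const c) \<in> tensor F UNIV 0" for c
      using F by (auto simp: resolves_def \<epsilon>_def Const_def tensor_iff lookup_single when_def)
    then show ?thesis by (metis UNIV_eq_I imageI)
  qed
  moreover have "diff F 0 ` tensor F UNIV (Suc 0) = {w \<in> tensor F UNIV 0. \<epsilon> w = 0}"
    using F by (simp add: resolves_def var_ideal_UNIV \<epsilon>_def)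
  ultimately have "graded_free_resolution_of_residue_field F"
    using F unfolding graded_free_resolution_of_residue_field_def resolves_def
    by (intro conjI exI[of _ \<epsilon>]) simp_all
  then show ?thesis unfolding residue_field_resolution_def by (rule someI)
qed

section \<open>Minimal generators\<close>

lemma single_mult_edge_binomial:
  "single m d * edge_binomial i j =
    single (m + single (X i) 1 + single (Y j) 1) d - single (m + single (X j) 1 + single (Y i) 1) d"
  by (simp add: edge_binomial_def Var_def mult_single right_diff_distrib add.assoc)

lemma monomial_eq_XY:
  fixes m :: "'v monomial"
  assumes "m + single (X i) 1 + single (Y j) 1 = single (X a) 1 + single (Y b) 1"
  shows "i = a \<and> j = b"
proof -
  have "lookup (m + single (X i) 1 + single (Y j) 1) z = lookup (single (X a) 1 + single (Y b) 1) z" for z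
    using assms by simp
  from this[of "X i"] this[of "Y j"] show ?thesis
    by (auto simp: lookup_add lookup_single when_def split: if_splits)
qed

text \<open>Terms of a multiple of this binomial are divisible by \<open>x_i y_j\<close> or
  \<open>x_j y_i\<close>, hence differ from \<open>x_a y_b\<close>. So the coefficient of
  \<open>x_a y_b\<close> detects whether the generator of the edge \<open>{a, b}\<close> has been
  omitted.\<close>

lemma lookup_mult_edge_binomial:
  assumes "{i, j} \<noteq> {a, b}"
  shows "lookup (c * edge_binomial i j) (single (X a) 1 + single (Y b) 1) = 0"
proof (induction c rule: poly_mapping_induct)
  case (single m d)
  have "m + single (X i) 1 + single (Y j) 1 \<noteq> single (X a) 1 + single (Y b) 1"
    "m + single (X j) 1 + single (Y i) 1 \<noteq> single (X a) 1 + single (Y b) 1"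
    using assms monomial_eq_XY[of m i j a b] monomial_eq_XY[of m j i a b]
    by (auto simp: insert_commute)
  then show ?case
    unfolding single_mult_edge_binomial by (simp add: lookup_minus lookup_single when_def)
qed (simp add: distrib_right lookup_add)

lemma lookup_edge_binomial_self:
  assumes "a \<noteq> b"
  shows "lookup (edge_binomial a b) (single (X a) 1 + single (Y b) 1) = (1 :: 'k::field)"
proof -
  have "0 + single (X b) 1 + single (Y a) 1 \<noteq> single (X a) 1 + single (Y b) (1::nat)"
    using monomial_eq_XY[of 0 b a a b] assms by blast
  then show ?thesis
    using single_mult_edge_binomial[of 0 "1::'k" a b]
    by (simp add: lookup_minus lookup_single when_def)
qed

lemma lookup_mult_edge_binomial_linear:
  fixes c :: "('v::finite, 'k::field) mpoly"
  shows "lookup (c * edge_binomial i j) (single z 1) = 0"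
proof (induction c rule: poly_mapping_induct)
  case (single m d)
  have "m + single z' 1 + single z'' 1 \<noteq> single z 1" for z' z'' :: "'v var"
  proof
    assume "m + single z' 1 + single z'' 1 = single z 1"
    then have "monomial_degree (m + single z' 1 + single z'' 1) = monomial_degree (single z 1)"
      by simp
    then show False unfolding monomial_degree_add by (simp add: monomial_degree_def)
  qed
  then show ?case
    unfolding single_mult_edge_binomial by (simp add: lookup_minus lookup_single when_def)
qed (simp add: distrib_right lookup_add)

lemma edge_binomial_swap: "edge_binomial j i = - edge_binomial i j"
  by (simp add: edge_binomial_def)

lemma homogeneous_edge_binomial:
  "homogeneous (edge_binomial i j :: ('v::finite, 'k::field) mpoly)"
proof -
  have XY: "homogeneous_of_degree 2 (Var z * Var z' :: ('v, 'k) mpoly)" for z z' :: "'v var"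
    using homogeneous_mult[OF Var_homogeneous Var_homogeneous] by fastforce
  have "hom_comp 2 (edge_binomial i j) = (edge_binomial i j :: ('v, 'k) mpoly)"
    using XY unfolding edge_binomial_def homogeneous_iff_hom_comp
    by (simp add: hom_comp_def mono_map_diff)
  then show ?thesis unfolding homogeneous_def homogeneous_iff_hom_comp by blast
qed

text \<open>The defining generators contain every edge binomial with both signs. \<open>D\<close>
  picks one orientation of each edge, and minimality then follows by looking at the coefficient of
  \<open>x_a y_b\<close> for an omitted \<open>(a, b)\<close>.\<close>

lemma minimal_generators_orientation:
  fixes D :: "('v::finite \<times> 'v) set"
  assumes ne: "\<And>i j. (i, j) \<in> D \<Longrightarrow> i \<noteq> j" and inj: "inj_on (\<lambda>(i, j). {i, j}) D"
    and E: "(\<lambda>(i, j). {i, j}) ` D = E"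
  shows "minimal_homogeneous_generators (binomial_edge_ideal E :: ('v, 'k::field) mpoly set)
    ((\<lambda>(i, j). edge_binomial i j) ` D)"
proof -
  let ?S = "(\<lambda>(i, j). edge_binomial i j :: ('v, 'k) mpoly) ` D"
  have gen: "ideal_generated ?S = binomial_edge_ideal E"
  proof
    show "ideal_generated ?S \<subseteq> binomial_edge_ideal E"
      unfolding binomial_edge_ideal_def using E by (intro ideal_generated_mono) auto
    show "binomial_edge_ideal E \<subseteq> ideal_generated ?S"
      unfolding binomial_edge_ideal_def
    proof (intro ideal_generated_subset ideal_ideal_generated subsetI)
      fix p :: "('v, 'k) mpoly" assume "p \<in> {edge_binomial i j |i j. {i, j} \<in> E}"
      then obtain i j where p: "p = edge_binomial i j" "{i, j} \<in> E" by blast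
      then obtain a b where ab: "(a, b) \<in> D" "{i, j} = {a, b}" using E by auto
      then have "edge_binomial a b \<in> ideal_generated ?S"
        by (intro ideal_generated_base) force
      then have "p \<in> ideal_generated ?S" if "p = edge_binomial a b \<or> p = - edge_binomial a b"
        using that ideal_minus[OF ideal_ideal_generated] by blast
      moreover have "(i, j) = (a, b) \<or> (i, j) = (b, a)" using ab(2) by (auto simp: doubleton_eq_iff)
      ultimately show "p \<in> ideal_generated ?S"
        using p(1) edge_binomial_swap[of b a] by blast
    qed
  qed
  have "ideal_generated T \<noteq> binomial_edge_ideal E" if T: "T \<subset> ?S" for T
  proof -
    obtain a b where ab: "(a, b) \<in> D" "edge_binomial a b \<notin> T" using T by auto
    have "lookup p (single (X a) 1 + single (Y b) 1) = 0" if "p \<in> ideal_generated T" for p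
      using that
    proof (induction rule: ideal_generated_induct)
      case (add c s q)
      then obtain d where d: "d \<in> D" "s = (\<lambda>(i, j). edge_binomial i j) d" using T by blast
      obtain i j where "d = (i, j)" by (cases d)
      then have ij: "(i, j) \<in> D" "s = edge_binomial i j" using d by simp_all
      then have "(i, j) \<noteq> (a, b)" using ab(2) add(1) by auto
      then have "{i, j} \<noteq> {a, b}" using inj_onD[OF inj _ ij(1) ab(1)] by auto
      then show ?case using add ij(2) by (simp add: lookup_add lookup_mult_edge_binomial[simplified])
    qed simp
    then have "edge_binomial a b \<notin> ideal_generated T"
      using lookup_edge_binomial_self[OF ne[OF ab(1)], where ?'k = 'k] by force
    moreover have "edge_binomial a b \<in> ideal_generated ?S"
      using ab(1) by (intro ideal_generated_base) force
    ultimately show ?thesis using gen by blast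
  qed
  then show ?thesis
    using gen by (auto simp: minimal_homogeneous_generators_def homogeneous_edge_binomial)
qed

lemma simple_graph_orientation:
  assumes "simple_graph E"
  obtains D where "\<And>i j. (i, j) \<in> D \<Longrightarrow> i \<noteq> j" "inj_on (\<lambda>(i, j). {i, j}) D"
    "(\<lambda>(i, j). {i, j}) ` D = E"
proof -
  have "\<exists>d. fst d \<noteq> snd d \<and> e = {fst d, snd d}" if e: "e \<in> E" for e
  proof -
    obtain a b where "a \<noteq> b" "e = {a, b}"
      using assms e card_2_iff[of e] by (auto simp: simple_graph_def)
    then show ?thesis by (intro exI[of _ "(a, b)"]) simp
  qed
  then obtain d where d: "\<And>e. e \<in> E \<Longrightarrow> fst (d e) \<noteq> snd (d e)"
    "\<And>e. e \<in> E \<Longrightarrow> e = {fst (d e), snd (d e)}" by metis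
  have d': "(\<lambda>(i, j). {i, j}) (d e) = e" if "e \<in> E" for e
    using d(2)[OF that] by (simp add: case_prod_beta)
  show ?thesis
  proof (rule that[of "d ` E"])
    fix i j assume "(i, j) \<in> d ` E"
    then obtain e where "e \<in> E" "d e = (i, j)" by force
    then show "i \<noteq> j" using d(1)[of e] by simp
  next
    show "inj_on (\<lambda>(i, j). {i, j}) (d ` E)"
    proof (rule inj_onI)
      fix x y assume "x \<in> d ` E" "y \<in> d ` E" and eq: "(\<lambda>(i, j). {i, j}) x = (\<lambda>(i, j). {i, j}) y"
      then obtain e e' where "e \<in> E" "x = d e" "e' \<in> E" "y = d e'" by blast
      then show "x = y" using d'[of e] d'[of e'] eq by simp
    qed
    show "(\<lambda>(i, j). {i, j}) ` d ` E = E" unfolding image_image using d' by simp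
  qed
qed

section \<open>Free vertices and cut edges\<close>

text \<open>By finiteness the edges from \<open>v\<close> to \<open>a\<close> and to
  \<open>b\<close> extend to maximal cliques; uniqueness makes these cliques equal.\<close>

lemma free_vertex_neighbours_adjacent:
  fixes E :: "'v::finite set set"
  assumes free: "free_vertex E v" and a: "{v, a} \<in> E" and b: "{v, b} \<in> E" and ab: "a \<noteq> b"
  shows "{a, b} \<in> E"
proof -
  have ex: "\<exists>C. maximal_clique E C \<and> v \<in> C \<and> w \<in> C" if "{v, w} \<in> E" for w
  proof -
    have "{v, w} \<in> {C. clique C E}" using that by (auto simp: clique_def insert_commute)
    then obtain C where C: "clique C E" "{v, w} \<subseteq> C" "\<And>C'. clique C' E \<Longrightarrow> C \<subseteq> C' \<Longrightarrow> C = C'"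
      using finite_has_maximal2[of "{C. clique C E}" "{v, w}"] by auto
    then have "maximal_clique E C" unfolding maximal_clique_def by blast
    then show ?thesis using C(2) by blast
  qed
  obtain C1 where C1: "maximal_clique E C1" "v \<in> C1" "a \<in> C1" using ex[OF a] by blast
  obtain C2 where C2: "maximal_clique E C2" "v \<in> C2" "b \<in> C2" using ex[OF b] by blast
  have "C1 = C2" using free C1 C2 unfolding free_vertex_def by blast
  then show ?thesis using C1 C2 ab by (auto simp: maximal_clique_def clique_def)
qed

text \<open>\<open>V\<close> is the component of \<open>u\<close> after removal of the edge. If it
  contained \<open>v\<close>, reachability and hence the set of components would not change.\<close>

lemma cut_edge_separates:
  assumes "cut_edge E {u, v}"
  shows "\<exists>V. u \<in> V \<and> v \<notin> V \<and> (\<forall>a b. {a, b} \<in> E - {{u, v}} \<longrightarrow> (a \<in> V \<longleftrightarrow> b \<in> V))"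
proof -
  let ?E = "E - {{u, v}}"
  let ?R = "{(a, b). {a, b} \<in> E}" and ?R' = "{(a, b). {a, b} \<in> ?E}"
  have sym: "sym ?R'" by (auto simp: sym_def insert_commute)
  have "(u, v) \<notin> ?R'\<^sup>*"
  proof
    assume uv: "(u, v) \<in> ?R'\<^sup>*"
    then have vu: "(v, u) \<in> ?R'\<^sup>*" using sym_rtrancl[OF sym] by (meson symD)
    have "?R \<subseteq> ?R'\<^sup>*"
    proof clarify
      fix a b assume ab: "{a, b} \<in> E"
      show "(a, b) \<in> ?R'\<^sup>*"
      proof (cases "{a, b} = {u, v}")
        case True
        then show ?thesis using uv vu by (auto simp: doubleton_eq_iff)
      next
        case False
        then show ?thesis using ab by (intro r_into_rtrancl) simp
      qed
    qed
    then have "?R\<^sup>* = ?R'\<^sup>*" by (intro rtrancl_subset) auto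
    then have "connected_components ?E = connected_components E"
      by (simp add: connected_components_def)
    then show False using assms by (simp add: cut_edge_def)
  qed
  moreover have "(u, a) \<in> ?R'\<^sup>* \<longleftrightarrow> (u, b) \<in> ?R'\<^sup>*" if "{a, b} \<in> ?E" for a b
  proof -
    have "(a, b) \<in> ?R'" "(b, a) \<in> ?R'" using that by (simp_all add: insert_commute)
    then show ?thesis by (meson rtrancl.rtrancl_into_rtrancl)
  qed
  ultimately show ?thesis by (intro exI[of _ "{w. (u, w) \<in> ?R'\<^sup>*}"]) simp
qed

theorem theorem1p2:
  fixes E :: "'v::finite set set" and u v :: 'v
  assumes "simple_graph E"
    and "{u, v} \<in> E"
    and "cut_edge E {u, v}"
    and "free_vertex (E - {{u, v}}) v"
  shows "complete_betti_splitting
           (binomial_edge_ideal E :: ('v, 'k::field) mpoly set)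
           (binomial_edge_ideal (E - {{u, v}}))
           (ideal_generated {edge_binomial u v})"
proof -
  let ?E = "E - {{u, v}}"
  let ?f = "edge_binomial u v :: ('v, 'k) mpoly"
  let ?I = "binomial_edge_ideal E :: ('v, 'k) mpoly set"
  let ?J = "binomial_edge_ideal ?E :: ('v, 'k) mpoly set"
  let ?K = "ideal_generated {?f}"
  have uv: "u \<noteq> v" using simple_graph_neq[OF assms(1,2)] .
  have E: "simple_graph ?E" using assms(1) by (simp add: simple_graph_def)
  obtain V where V: "u \<in> V" "v \<notin> V" "\<And>a b. {a, b} \<in> ?E \<Longrightarrow> a \<in> V \<longleftrightarrow> b \<in> V"
    using cut_edge_separates[OF assms(3)] by blast
  obtain D where D: "\<And>i j. (i, j) \<in> D \<Longrightarrow> i \<noteq> j" "inj_on (\<lambda>(i, j). {i, j}) D"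
    "(\<lambda>(i, j). {i, j}) ` D = ?E"
    using simple_graph_orientation[OF E] by blast
  \<comment> \<open>Adding \<open>(u, v)\<close> to the orientation of \<open>?E\<close> makes the
    generators of \<open>?I\<close> literally the union of those of \<open>?J\<close> with
    \<open>?f\<close>.\<close>
  let ?D = "insert (u, v) D"
  let ?b = "\<lambda>(i, j). edge_binomial i j :: ('v, 'k) mpoly"
  have D_edge: "{i, j} \<noteq> {u, v}" if "(i, j) \<in> D" for i j
  proof -
    have "(\<lambda>(i, j). {i, j}) (i, j) \<in> ?E" unfolding D(3)[symmetric] using that by (rule imageI)
    then show ?thesis by simp
  qed
  have min_J: "minimal_homogeneous_generators ?J (?b ` D)"
    by (rule minimal_generators_orientation[OF D])
  have "minimal_homogeneous_generators ?I (?b ` ?D)"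
  proof (rule minimal_generators_orientation)
    show "i \<noteq> j" if "(i, j) \<in> ?D" for i j using that uv D(1) by auto
    show "inj_on (\<lambda>(i, j). {i, j}) ?D" using D(2) D_edge by (force simp: inj_on_def)
    show "(\<lambda>(i, j). {i, j}) ` ?D = E" using D(3) assms(2) by auto
  qed
  then have min_I: "minimal_homogeneous_generators ?I (?b ` D \<union> {?f})" by simp
  have min_K: "minimal_homogeneous_generators ?K {?f}"
  proof -
    have K: "minimal_homogeneous_generators (binomial_edge_ideal {{u, v}}) {?f}"
      using minimal_generators_orientation[of "{(u, v)}" "{{u, v}}", where ?'k = 'k] uv by simp
    then have "?K = binomial_edge_ideal {{u, v}}" by (simp add: minimal_homogeneous_generators_def)
    then show ?thesis using K by simp
  qed
  have disj: "?b ` D \<inter> {?f} = {}"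
  proof -
    have "?b d \<noteq> ?f" if "d \<in> D" for d
    proof (cases d)
      case (Pair i j)
      then show ?thesis
        using lookup_mult_edge_binomial[OF D_edge, of i j "1 :: ('v, 'k) mpoly"] that
          lookup_edge_binomial_self[OF uv, where ?'k = 'k] by auto
    qed
    then show ?thesis by blast
  qed
  have hom: "homogeneous_ideal ?I" "homogeneous_ideal ?J" "homogeneous_ideal ?K"
    using min_I min_J min_K unfolding minimal_homogeneous_generators_def homogeneous_ideal_def
    by metis+
  have sum: "?I = {a + b | a b. a \<in> ?J \<and> b \<in> ?K}"
    using min_I min_J ideal_generated_Un[of "?b ` D" "{?f}"]
    by (simp add: minimal_homogeneous_generators_def)
  have colon: "Var (X u) * c \<in> ?J \<and> Var (Y u) * c \<in> ?J" if "c * ?f \<in> ?J" for c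
    unfolding binomial_edge_ideal_eq
  proof (rule colon_edge_binomial[OF E _ V(3) V(1,2)])
    show "{a, b} \<in> ?E" if "{v, a} \<in> ?E" "{v, b} \<in> ?E" "a \<noteq> b" for a b
      using free_vertex_neighbours_adjacent[OF assms(4)] that by blast
    show "c * ?f \<in> vertex_edge_ideal {} ?E" using that by (simp add: binomial_edge_ideal_eq)
  qed simp_all
  have linear: "lookup p (single z 1) = 0" if "p \<in> ?J" for p z
    using that unfolding binomial_edge_ideal_def
  proof (induction rule: ideal_generated_induct)
    case (add c s q)
    then show ?case by (auto simp: lookup_add lookup_mult_edge_binomial_linear[simplified])
  qed simp
  \<comment> \<open>The coefficient of \<open>x_u\<close> in \<open>Var (X u) * c\<close>, an
    element of \<open>?J\<close>, is the constant term of \<open>c\<close>.\<close>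
  have const: "lookup c 0 = 0" if "c * ?f \<in> ?J" for c
    using linear[of "Var (X u) * c" "X u"] colon[OF that] lookup_Var_mult[of "X u" c 0] by simp
  have f0: "?f \<noteq> 0" using lookup_edge_binomial_self[OF uv, where ?'k = 'k] by force
  let ?F = "residue_field_resolution :: ('v, 'k) free_complex"
  have res: "graded_free_resolution_of_residue_field ?F" by (rule residue_field_resolution)
  then obtain \<epsilon> where eps: "module_hom vec_scale residue_scale \<epsilon>"
    "diff ?F 0 ` tensor ?F UNIV (Suc 0) = {w \<in> tensor ?F UNIV 0. \<epsilon> w = 0}"
    unfolding graded_free_resolution_of_residue_field_def by (elim conjE exE) (rule that)
  have "residue_resolution ?F \<epsilon>"
    using res eps unfolding graded_free_resolution_of_residue_field_def residue_resolution_def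
    by simp
  then interpret R: residue_resolution ?F \<epsilon> .
  have betti: "betti L i j = R.tor_dim L (nat i) j" if "i \<ge> 0" for L i j
    using that
    by (simp add: betti_def R.tor_dim_def R.cycles_def R.boundaries_def Tor_cycles_def
        Tor_boundaries_def chain_cycle_def)
  have split: "R.tor_dim ?I i j = R.tor_dim ?J i j + R.tor_dim ?K i j +
      (if i = 0 then 0 else R.tor_dim (?J \<inter> ?K) (i - 1) j)" for i j
    using R.cycle_in_intersection[OF ideal_binomial_edge_ideal colon const f0]
    by (intro R.tor_dim_splitting graded_homogeneous_ideal hom sum) simp_all
  have "betti ?I i j = betti ?J i j + betti ?K i j + betti (?J \<inter> ?K) (i - 1) j" if "i \<ge> 0" for i j
  proof (cases "i = 0")
    case True
    have "betti (?J \<inter> ?K) (i - 1) j = 0" using True by (simp add: betti_def)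
    then show ?thesis using split[of 0 j] betti[of 0] True by simp
  next
    case False
    then have "nat i \<noteq> 0" "nat (i - 1) = nat i - 1" "i - 1 \<ge> 0" using that by auto
    then show ?thesis using split[of "nat i" j] betti[OF that] betti[of "i - 1"] by simp
  qed
  then show ?thesis
    unfolding complete_betti_splitting_def using hom sum min_I min_J min_K disj by blast
qed

end
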